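(* Let $N\in\mathbb{N}$ with $N\ge \deg(\phi)$. There exist two positive constants $\omega_N,\lambda_N$, depending only on $N$ and $\phi$, such that for every $K\in\mathbb{N}$ and every solution $\tilde h$ of the semi-discrete scheme with truncation parameters $K,N$ whose initial datum $h_0$ satisfies the zero-invariants condition, $$\forall t\ge 0,\qquad \|\tilde h(t)\|_{L^2(\mathcal{M})}\le \omega_N\, e^{-\lambda_N t}\,\|\tilde h(0)\|_{L^2(\mathcal{M})}.$$
   Context: Potential. $\phi:\mathbb{R}\to\mathbb{R}$ is an even polynomial of degree $2m$, $m\ge 1$, with positive leading coefficient; $\rho:=e^{-\phi}$ and it is assumed that $\int_{\mathbb{R}}\rho\,dx=1$ and $\int_{\mathbb{R}}\phi''\rho\,dx=1$. The potential is called harmonic if $\phi(x)=\frac12(x^2+\ln(2\pi))$ (with this normalization, this is the only case with $\deg\phi=2$). Notation. $\langle f,g\rangle=\int_{\mathbb{R}} fg\rho\,dx$, $\langle f\rangle=\int_{\mathbb{R}} f\rho\,dx$. $\mu(v)=\frac{1}{\sqrt{2\pi}}e^{-v^2/2}$, $\mathcal{M}(x,v)=\mu(v)\rho(x)$, $\|f\|_{L^2(\mathcal{M})}=\left(\int_{\mathbb{R}\times\mathbb{R}}f^2\mathcal{M}\,dx\,dv\right)^{1/2}$. $(\tilde P_n)_{n\ge0}$ are the orthonormal polynomials for the weight $\rho$ ($\deg\tilde P_n=n$, positive leading coefficient) and $(\tilde H_k)_{k\ge0}$ the orthonormal (Hermite) polynomials for the weight $\mu$. $\delta_{k\ge3}=1$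 if $k\ge3$ and $0$ otherwise. Semi-discrete scheme. Given $K,N\in\mathbb{N}$ and $h_0\in L^2(\mathbb{R}\times\mathbb{R},\mathcal{M}\,dx\,dv)$, the coefficients $\tilde C_{k,n}(t)$, $0\le k\le K$, $0\le n\le N$, $t\ge 0$, solve the linear ODE system $$\frac{d}{dt}\tilde C_{k,n}=\sqrt{k+1}\sum_{r=0}^N\langle\tilde P_r,\partial_x\tilde P_n\rangle\tilde C_{k+1,r}-\sqrt{k}\sum_{r=0}^N\langle\tilde P_n,\partial_x\tilde P_r\rangle\tilde C_{k-1,r}-\delta_{k\ge3}\tilde C_{k,n},$$ with $\tilde C_{-1,n}=\tilde C_{K+1,n}=0$ for $0\le n\le N$ and $\tilde C_{k,n}(0)=\int_{\mathbb{R}\times\mathbb{R}}h_0(x,v)\tilde P_n(x)\tilde H_k(v)\mathcal{M}(x,v)\,dx\,dv$. Set $\tilde C_k(t,x)=\sum_{n=0}^N\tilde C_{k,n}(t)\tilde P_n(x)$ and $\tilde h(t,x,v)=\sum_{k=0}^K\tilde C_k(t,x)\tilde H_k(v)$; $\tilde h$ is called the solution of the semi-discrete scheme. Zero-invariants condition on $h_0$. Put $r_0(x)=\int_{\mathbb{R}}h_0\tilde H_0\,\mu\,dv$, $m_0(x)=\int_{\mathbb{R}}h_0\tilde H_1\,\mu\,dv$, $e_0(x)=\int_{\mathbb{R}}h_0\tilde H_2\,\mu\,dv$. The condition is: $\langle r_0\rangle=0$ and $\frac1{\sqrt2}\langle e_0\rangle+\langle\phi r_0\rangle=0$; and, if $\phi$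 is harmonic, in addition $\langle x r_0\rangle=0$, $\langle m_0\rangle=0$, $\langle x m_0\rangle=0$ and $\frac1{\sqrt2}\langle e_0\rangle-\langle\phi r_0\rangle=0$.
   Formalization: The result is stated for every K ≥ 3 rather than every K: for K ≤ 2 no damping term occurs and the norm is conserved, so the claim fails (e.g. initial datum the degree-1 orthonormal polynomial in x, for non-harmonic potentials). *)

theory Defs
  imports "HOL-Probability.Probability" "HOL-Computational_Algebra.Polynomial"
begin

definition rho :: "real poly \<Rightarrow> real \<Rightarrow> real" where
  "rho \<phi> x = exp (- poly \<phi> x)"

definition potential :: "real poly \<Rightarrow> bool" where
  "potential \<phi> \<longleftrightarrow>
     (\<forall>x. poly \<phi> (- x) = poly \<phi> x) \<and>
     (\<exists>m\<ge>1. degree \<phi> = 2 * m) \<and>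
     lead_coeff \<phi> > 0 \<and>
     (LINT x|lborel. rho \<phi> x) = 1 \<and>
     (LINT x|lborel. poly (pderiv (pderiv \<phi>)) x * rho \<phi> x) = 1"

definition harmonic :: "real poly \<Rightarrow> bool" where
  "harmonic \<phi> \<longleftrightarrow> (\<forall>x. poly \<phi> x = (x\<^sup>2 + ln (2 * pi)) / 2)"

definition avg :: "real poly \<Rightarrow> (real \<Rightarrow> real) \<Rightarrow> real" where
  "avg \<phi> f = (LINT x|lborel. f x * rho \<phi> x)"

definition ip :: "real poly \<Rightarrow> (real \<Rightarrow> real) \<Rightarrow> (real \<Rightarrow> real) \<Rightarrow> real" where
  "ip \<phi> f g = (LINT x|lborel. f x * g x * rho \<phi> x)"

text \<open>The velocity weight \<open>\<mu>\<close> is the library's \<^const>\<open>normal_density\<close> with mean 0 and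
  standard deviation 1. Phase-space points are pairs \<open>(x, v)\<close>.\<close>

definition Maxw :: "real poly \<Rightarrow> real \<times> real \<Rightarrow> real" where
  "Maxw \<phi> = (\<lambda>(x, v). std_normal_density v * rho \<phi> x)"

text \<open>Elements of the weighted \<open>L\<^sup>2\<close> space are represented by Borel functions; every class of
  almost everywhere equal functions has such a representative.\<close>

definition in_L2 :: "real poly \<Rightarrow> (real \<times> real \<Rightarrow> real) \<Rightarrow> bool" where
  "in_L2 \<phi> f \<longleftrightarrow> f \<in> borel_measurable borel \<and> integrable lborel (\<lambda>z. (f z)\<^sup>2 * Maxw \<phi> z)"

definition L2_norm :: "real poly \<Rightarrow> (real \<times> real \<Rightarrow> real) \<Rightarrow> real" where
  "L2_norm \<phi> f = sqrt (LINT z|lborel. (f z)\<^sup>2 * Maxw \<phi> z)"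

definition orthonormal_polys :: "(real \<Rightarrow> real) \<Rightarrow> (nat \<Rightarrow> real poly) \<Rightarrow> bool" where
  "orthonormal_polys w Q \<longleftrightarrow>
     (\<forall>n. degree (Q n) = n \<and> lead_coeff (Q n) > 0) \<and>
     (\<forall>m n. (LINT x|lborel. poly (Q m) x * poly (Q n) x * w x) = (if m = n then 1 else 0))"

text \<open>\<open>C k n t\<close> is the coefficient with velocity index \<open>k\<close> and space index \<open>n\<close> at time \<open>t\<close>.
  The convention that the coefficients with \<open>k = -1\<close> vanish is the case \<open>k = 0\<close> of the
  second sum; the derivative at time 0 is one-sided. For \<open>K \<le> 2\<close> no damping term
  occurs and the system is skew-symmetric, so the norm is conserved: decay needs \<open>K \<ge> 3\<close>.\<close>

definition scheme_coeffs ::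
  "real poly \<Rightarrow> (nat \<Rightarrow> real poly) \<Rightarrow> (nat \<Rightarrow> real poly) \<Rightarrow> nat \<Rightarrow> nat \<Rightarrow>
   (real \<times> real \<Rightarrow> real) \<Rightarrow> (nat \<Rightarrow> nat \<Rightarrow> real \<Rightarrow> real) \<Rightarrow> bool" where
  "scheme_coeffs \<phi> P H K N h0 C \<longleftrightarrow>
     (\<forall>k\<le>K. \<forall>n\<le>N. \<forall>t\<ge>0.
        (C k n has_real_derivative
           sqrt (real (k + 1)) *
             (\<Sum>r\<le>N. ip \<phi> (poly (P r)) (poly (pderiv (P n))) * C (k + 1) r t)
           - sqrt (real k) *
             (\<Sum>r\<le>N. ip \<phi> (poly (P n)) (poly (pderiv (P r))) *
                        (if k = 0 then 0 else C (k - 1) r t))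
           - (if k \<ge> 3 then 1 else 0) * C k n t) (at t within {0..})) \<and>
     (\<forall>n\<le>N. \<forall>t\<ge>0. C (K + 1) n t = 0) \<and>
     (\<forall>k\<le>K. \<forall>n\<le>N. C k n 0 =
        (LINT (x, v)|lborel. h0 (x, v) * poly (P n) x * poly (H k) v * Maxw \<phi> (x, v)))"

definition semi_discrete_solution ::
  "real poly \<Rightarrow> (nat \<Rightarrow> real poly) \<Rightarrow> (nat \<Rightarrow> real poly) \<Rightarrow> nat \<Rightarrow> nat \<Rightarrow>
   (real \<times> real \<Rightarrow> real) \<Rightarrow> (real \<Rightarrow> real \<times> real \<Rightarrow> real) \<Rightarrow> bool" where
  "semi_discrete_solution \<phi> P H K N h0 h \<longleftrightarrow>
     (\<exists>C. scheme_coeffs \<phi> P H K N h0 C \<and>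
          (\<forall>t\<ge>0. \<forall>x v. h t (x, v) =
             (\<Sum>k\<le>K. (\<Sum>n\<le>N. C k n t * poly (P n) x) * poly (H k) v)))"

definition v_moment :: "(nat \<Rightarrow> real poly) \<Rightarrow> nat \<Rightarrow> (real \<times> real \<Rightarrow> real) \<Rightarrow> real \<Rightarrow> real" where
  "v_moment H k h0 x = (LINT v|lborel. h0 (x, v) * poly (H k) v * std_normal_density v)"

definition zero_invariants ::
  "real poly \<Rightarrow> (nat \<Rightarrow> real poly) \<Rightarrow> (real \<times> real \<Rightarrow> real) \<Rightarrow> bool" where
  "zero_invariants \<phi> H h0 \<longleftrightarrow>
     (let r0 = v_moment H 0 h0; m0 = v_moment H 1 h0; e0 = v_moment H 2 h0 in
        avg \<phi> r0 = 0 \<and>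
        1 / sqrt 2 * avg \<phi> e0 + avg \<phi> (\<lambda>x. poly \<phi> x * r0 x) = 0 \<and>
        (harmonic \<phi> \<longrightarrow>
           avg \<phi> (\<lambda>x. x * r0 x) = 0 \<and>
           avg \<phi> m0 = 0 \<and>
           avg \<phi> (\<lambda>x. x * m0 x) = 0 \<and>
           1 / sqrt 2 * avg \<phi> e0 - avg \<phi> (\<lambda>x. poly \<phi> x * r0 x) = 0))"

end

theory Submission
  imports Defs
begin

text \<open>
  Write \<open>c\<^sub>k\<close> for the polynomial of degree at most \<open>N\<close> formed by the coefficients with velocity index \<open>k\<close>, and
  \<open>A\<close> for the derivative on polynomials of degree at most \<open>N\<close>, with adjoint \<open>A\<^sup>*\<close> for the weight \<open>\<rho>\<close>.  The scheme is
  \<open>c\<^sub>k' = sqrt (k + 1) A\<^sup>* c\<^sub>k\<^sub>+\<^sub>1 - sqrt k A c\<^sub>k\<^sub>-\<^sub>1\<close>, minus \<open>c\<^sub>k\<close> if \<open>k \<ge> 3\<close>.  The transport part is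
  skew-symmetric, so the squared norm decreases exactly by the damping of the levels \<open>k \<ge> 3\<close>, and the task
  is to show that the three undamped levels are drained into the damped ones.

  The tool is a calculus of damped observables.  A scalar observable of the trajectory is called damped if
  its square can be absorbed, up to an arbitrarily small multiple of the energy of the levels 0, 1, 2 and a
  multiple of the energy of the levels 3 and 4, by the time derivative of a bounded quadratic
  functional.  Damped observables form a linear space which contains the moments of level 3 and is closed
  under the time derivative (\<open>damped_derivative\<close>).  If every coefficient of the levels 0, 1, 2 is
  damped, adding a small multiple of the resulting functional to the energy gives exponential decay
  (\<open>exponential_decay\<close>).  Only the levels up to 4 enter the functional, hence the constants do not depend
  on the number of velocity modes.

  It remains to generate all observables.  Differentiating level 3 gives \<open>A c\<^sub>2\<close>, which is \<open>c\<^sub>2\<close> up to its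
  mean \<open>\<sigma>\<close>.  Differentiating \<open>A c\<^sub>2\<close> gives \<open>c\<^sub>1\<close> up to an affine part \<open>a x + b\<close>.  Differentiating once
  more gives \<open>c\<^sub>0 - sqrt 2 \<sigma> \<phi>\<close> up to a quadratic polynomial, and the derivative of this relation constrains
  \<open>a\<close> and \<open>b\<close>: if \<open>\<phi>\<close> has degree at least 4 they turn out to be damped, and in the harmonic case they vanish by
  the additional invariants (\<open>dissipated_level_1_basis\<close>).  Then \<open>c\<^sub>0\<close> equals \<open>sqrt 2 \<sigma> \<phi>\<close> up to a constant, which
  mass conservation determines, and energy conservation leaves only \<open>\<sigma> = 0\<close> since \<open>\<phi>\<close> has positive variance
  (\<open>dissipated_level_2\<close>).  The assumption \<open>N \<ge> degree \<phi>\<close> guarantees that \<open>A\<^sup>* 1 = \<phi>'\<close> and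
  \<open>A\<^sup>* x = x \<phi>' - 1\<close> hold in spite of the truncation and that the energy is a function of the coefficients.\<close>

section \<open>Damped observables and hypocoercivity\<close>

text \<open>
  In the applications \<open>S\<close> is a set of trajectories, \<open>Z\<close> is a part of the energy that the
  flow damps and \<open>Y\<close> the part that must be controlled although nothing damps it directly.
  The functional \<open>F\<close> is a multiplier: when a small multiple of it is added to the energy, the
  modified energy also loses a multiple of \<open>q\<close>, up to \<open>\<epsilon> Y\<close> and a term that the damping absorbs.
  The data \<open>B\<close>, \<open>F\<close> and \<open>F'\<close> are chosen before the trajectory, so every estimate below is uniform
  over \<open>S\<close>.\<close>

definition dissipates ::
  "'a set \<Rightarrow> ('a \<Rightarrow> real \<Rightarrow> real) \<Rightarrow> ('a \<Rightarrow> real \<Rightarrow> real) \<Rightarrow> ('a \<Rightarrow> real \<Rightarrow> real) \<Rightarrow> real \<Rightarrow> real \<Rightarrow>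
   ('a \<Rightarrow> real \<Rightarrow> real) \<Rightarrow> ('a \<Rightarrow> real \<Rightarrow> real) \<Rightarrow> bool" where
  "dissipates S Y Z q \<epsilon> B F F' \<longleftrightarrow> B \<ge> 0 \<and> (\<forall>a\<in>S. \<forall>t\<ge>0.
     (F a has_real_derivative F' a t) (at t within {0..}) \<and>
     \<bar>F a t\<bar> \<le> B * (Y a t + Z a t) \<and>
     F' a t \<le> - q a t + \<epsilon> * Y a t + B * Z a t)"

text \<open>
  Since \<open>\<epsilon>\<close> is arbitrary, the damped observables form a linear space that is closed under the time
  derivative of the flow.  This closure plays the role of the Kalman rank condition, but it needs
  neither iterated commutators nor a hierarchy of weights.\<close>

definition damped ::
  "'a set \<Rightarrow> ('a \<Rightarrow> real \<Rightarrow> real) \<Rightarrow> ('a \<Rightarrow> real \<Rightarrow> real) \<Rightarrow> ('a \<Rightarrow> real \<Rightarrow> real) \<Rightarrow> bool" where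
  "damped S Y Z u \<longleftrightarrow> (\<forall>\<epsilon>>0. \<exists>B F F'. dissipates S Y Z (\<lambda>a t. (u a t)\<^sup>2) \<epsilon> B F F')"

lemma dissipatesD:
  assumes "dissipates S Y Z q \<epsilon> B F F'"
  shows "B \<ge> 0"
    "\<And>a t. a \<in> S \<Longrightarrow> t \<ge> 0 \<Longrightarrow> (F a has_real_derivative F' a t) (at t within {0..})"
    "\<And>a t. a \<in> S \<Longrightarrow> t \<ge> 0 \<Longrightarrow> \<bar>F a t\<bar> \<le> B * (Y a t + Z a t)"
    "\<And>a t. a \<in> S \<Longrightarrow> t \<ge> 0 \<Longrightarrow> F' a t \<le> - q a t + \<epsilon> * Y a t + B * Z a t"
  using assms unfolding dissipates_def by auto

lemma damped_cong:
  assumes "damped S Y Z u" "\<And>a t. a \<in> S \<Longrightarrow> t \<ge> 0 \<Longrightarrow> v a t = u a t"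
  shows "damped S Y Z v"
  using assms unfolding damped_def dissipates_def by simp

text \<open>
  For an observable dominated by the damping itself the zero multiplier is good enough.\<close>

lemma damped_of_le:
  assumes "c \<ge> 0" "\<And>a t. a \<in> S \<Longrightarrow> t \<ge> 0 \<Longrightarrow> (u a t)\<^sup>2 \<le> c * Z a t"
    "\<And>a t. a \<in> S \<Longrightarrow> t \<ge> 0 \<Longrightarrow> 0 \<le> Y a t" "\<And>a t. a \<in> S \<Longrightarrow> t \<ge> 0 \<Longrightarrow> 0 \<le> Z a t"
  shows "damped S Y Z u"
  unfolding damped_def
proof (intro allI impI)
  fix \<epsilon> :: real assume "\<epsilon> > 0"
  have "- (u a t)\<^sup>2 + \<epsilon> * Y a t + c * Z a t \<ge> 0" if "a \<in> S" "t \<ge> 0" for a t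
    using assms(2)[OF that] mult_nonneg_nonneg[of \<epsilon> "Y a t"] assms(3)[OF that] \<open>\<epsilon> > 0\<close>
    by linarith
  then show "\<exists>B F F'. dissipates S Y Z (\<lambda>a t. (u a t)\<^sup>2) \<epsilon> B F F'"
    using assms unfolding dissipates_def by (intro exI[of _ c] exI[of _ "\<lambda>_ _. 0"]) auto
qed

lemma damped_scale:
  assumes "damped S Y Z u"
    "\<And>a t. a \<in> S \<Longrightarrow> t \<ge> 0 \<Longrightarrow> 0 \<le> Y a t" "\<And>a t. a \<in> S \<Longrightarrow> t \<ge> 0 \<Longrightarrow> 0 \<le> Z a t"
  shows "damped S Y Z (\<lambda>a t. c * u a t)"
proof (cases "c = 0")
  case True
  then show ?thesis by (intro damped_of_le[of 0]) (use assms in auto)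
next
  case False
  then have c: "c\<^sup>2 > 0" by simp
  show ?thesis
    unfolding damped_def
  proof (intro allI impI)
    fix \<epsilon> :: real assume "\<epsilon> > 0"
    with c have "\<epsilon> / c\<^sup>2 > 0" by simp
    from assms(1) this obtain B F F' where BF: "dissipates S Y Z (\<lambda>a t. (u a t)\<^sup>2) (\<epsilon> / c\<^sup>2) B F F'"
    unfolding damped_def by blast
  note B = dissipatesD(1)[OF BF] and d = dissipatesD(2)[OF BF]
    and b = dissipatesD(3)[OF BF] and e = dissipatesD(4)[OF BF]
    have "((\<lambda>t. c\<^sup>2 * F a t) has_real_derivative c\<^sup>2 * F' a t) (at t within {0..}) \<and>
        \<bar>c\<^sup>2 * F a t\<bar> \<le> (c\<^sup>2 * B) * (Y a t + Z a t) \<and>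
        c\<^sup>2 * F' a t \<le> - (c * u a t)\<^sup>2 + \<epsilon> * Y a t + (c\<^sup>2 * B) * Z a t"
      if "a \<in> S" "t \<ge> 0" for a t
    proof (intro conjI)
      show "((\<lambda>t. c\<^sup>2 * F a t) has_real_derivative c\<^sup>2 * F' a t) (at t within {0..})"
        by (intro DERIV_cmult d that)
      show "\<bar>c\<^sup>2 * F a t\<bar> \<le> (c\<^sup>2 * B) * (Y a t + Z a t)"
        using mult_left_mono[OF b[OF that], of "c\<^sup>2"] by (simp add: abs_mult mult.assoc)
      show "c\<^sup>2 * F' a t \<le> - (c * u a t)\<^sup>2 + \<epsilon> * Y a t + (c\<^sup>2 * B) * Z a t"
        using mult_left_mono[OF e[OF that], of "c\<^sup>2"] c
        by (simp add: algebra_simps power_mult_distrib)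
    qed
    then show "\<exists>B F F'. dissipates S Y Z (\<lambda>a t. (c * u a t)\<^sup>2) \<epsilon> B F F'"
    using B unfolding dissipates_def 
      by (intro exI[of _ "c\<^sup>2 * B"] exI[of _ "\<lambda>a t. c\<^sup>2 * F a t"]
          exI[of _ "\<lambda>a t. c\<^sup>2 * F' a t"]) simp
  qed
qed

lemma damped_add:
  assumes "damped S Y Z u" "damped S Y Z v"
  shows "damped S Y Z (\<lambda>a t. u a t + v a t)"
  unfolding damped_def
proof (intro allI impI)
  fix \<epsilon> :: real assume "\<epsilon> > 0"
  then have "\<epsilon> / 4 > 0" by simp
  from assms(1) this obtain B F F' where BF: "dissipates S Y Z (\<lambda>a t. (u a t)\<^sup>2) (\<epsilon> / 4) B F F'"
    unfolding damped_def by blast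
  note B = dissipatesD(1)[OF BF] and d = dissipatesD(2)[OF BF]
    and b = dissipatesD(3)[OF BF] and e = dissipatesD(4)[OF BF]
  from assms(2) \<open>\<epsilon> / 4 > 0\<close> obtain C G G' where CG: "dissipates S Y Z (\<lambda>a t. (v a t)\<^sup>2) (\<epsilon> / 4) C G G'"
    unfolding damped_def by blast
  note C = dissipatesD(1)[OF CG] and d2 = dissipatesD(2)[OF CG]
    and b2 = dissipatesD(3)[OF CG] and e2 = dissipatesD(4)[OF CG]
  have "((\<lambda>t. 2 * (F a t + G a t)) has_real_derivative 2 * (F' a t + G' a t)) (at t within {0..}) \<and>
      \<bar>2 * (F a t + G a t)\<bar> \<le> 2 * (B + C) * (Y a t + Z a t) \<and>
      2 * (F' a t + G' a t) \<le> - (u a t + v a t)\<^sup>2 + \<epsilon> * Y a t + 2 * (B + C) * Z a t"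
    if "a \<in> S" "t \<ge> 0" for a t
  proof (intro conjI)
    show "((\<lambda>t. 2 * (F a t + G a t)) has_real_derivative 2 * (F' a t + G' a t)) (at t within {0..})"
      by (intro DERIV_cmult DERIV_add d d2 that)
    show "\<bar>2 * (F a t + G a t)\<bar> \<le> 2 * (B + C) * (Y a t + Z a t)"
      using b[OF that] b2[OF that] by (simp add: algebra_simps)
    have "(u a t + v a t)\<^sup>2 \<le> 2 * (u a t)\<^sup>2 + 2 * (v a t)\<^sup>2"
      using zero_le_power2[of "u a t - v a t"] by (simp add: power2_eq_square algebra_simps)
    then show "2 * (F' a t + G' a t) \<le> - (u a t + v a t)\<^sup>2 + \<epsilon> * Y a t + 2 * (B + C) * Z a t"
      using e[OF that] e2[OF that] by (simp add: algebra_simps)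
  qed
  then show "\<exists>B F F'. dissipates S Y Z (\<lambda>a t. (u a t + v a t)\<^sup>2) \<epsilon> B F F'"
    using B C unfolding dissipates_def 
    by (intro exI[of _ "2 * (B + C)"] exI[of _ "\<lambda>a t. 2 * (F a t + G a t)"]
        exI[of _ "\<lambda>a t. 2 * (F' a t + G' a t)"]) simp
qed

text \<open>
  The multiplier for \<open>w\<close> is \<open>- 2 u w\<close>: its derivative is \<open>- 2 w\<^sup>2\<close> up to a product with \<open>r\<close>, which the
  damping controls, and the term \<open>- 2 u w'\<close>.  Young's inequality bounds the latter by a small multiple of
  the energy plus a large multiple of \<open>u\<^sup>2\<close>, and a large multiple of the multiplier of \<open>u\<close> pays for \<open>u\<^sup>2\<close>.\<close>

lemma damped_time_derivative:
  assumes u: "damped S Y Z u" and c: "c \<ge> 0"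
    and nn: "\<And>a t. a \<in> S \<Longrightarrow> t \<ge> 0 \<Longrightarrow> 0 \<le> Y a t" "\<And>a t. a \<in> S \<Longrightarrow> t \<ge> 0 \<Longrightarrow> 0 \<le> Z a t"
    and du: "\<And>a t. a \<in> S \<Longrightarrow> t \<ge> 0 \<Longrightarrow> (u a has_real_derivative w a t + r a t) (at t within {0..})"
    and dw: "\<And>a t. a \<in> S \<Longrightarrow> t \<ge> 0 \<Longrightarrow> (w a has_real_derivative w' a t) (at t within {0..})"
    and bu: "\<And>a t. a \<in> S \<Longrightarrow> t \<ge> 0 \<Longrightarrow> (u a t)\<^sup>2 \<le> c * (Y a t + Z a t)"
    and bw: "\<And>a t. a \<in> S \<Longrightarrow> t \<ge> 0 \<Longrightarrow> (w a t)\<^sup>2 \<le> c * (Y a t + Z a t)"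
    and bw': "\<And>a t. a \<in> S \<Longrightarrow> t \<ge> 0 \<Longrightarrow> (w' a t)\<^sup>2 \<le> c * (Y a t + Z a t)"
    and br: "\<And>a t. a \<in> S \<Longrightarrow> t \<ge> 0 \<Longrightarrow> (r a t)\<^sup>2 \<le> c * Z a t"
  shows "damped S Y Z w"
  unfolding damped_def
proof (intro allI impI)
  fix \<epsilon> :: real assume \<epsilon>: "\<epsilon> > 0"
  define \<delta> where "\<delta> = \<epsilon> / (2 * (c + 1))"
  have \<delta>: "\<delta> > 0" "\<delta> * c \<le> \<epsilon> / 2"
    using c \<epsilon> unfolding \<delta>_def by (auto simp: field_simps)
  then have "\<delta> * (\<epsilon> / 2) > 0" using \<epsilon> by simp
  from u this obtain B F F' where BF: "dissipates S Y Z (\<lambda>a t. (u a t)\<^sup>2) (\<delta> * (\<epsilon> / 2)) B F F'"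
    unfolding damped_def by blast
  note B = dissipatesD(1)[OF BF] and d = dissipatesD(2)[OF BF]
    and b = dissipatesD(3)[OF BF] and e = dissipatesD(4)[OF BF]
  \<comment> \<open>The weight \<open>1 / \<delta>\<close> is exactly the factor of \<open>u\<^sup>2\<close> in Young's inequality for \<open>2 u w'\<close>.\<close>
  define G where "G = (\<lambda>a t. F a t / \<delta> - 2 * (u a t * w a t))"
  define G' where "G' = (\<lambda>a t. F' a t / \<delta> - 2 * ((w a t + r a t) * w a t + w' a t * u a t))"
  define D where "D = 2 * c + \<delta> * c + B / \<delta>"
  have D: "D \<ge> 0" using c \<delta> B by (simp add: D_def)
  have "(G a has_real_derivative G' a t) (at t within {0..}) \<and>
      \<bar>G a t\<bar> \<le> D * (Y a t + Z a t) \<and>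
      G' a t \<le> - (w a t)\<^sup>2 + \<epsilon> * Y a t + D * Z a t" if at: "a \<in> S" "t \<ge> 0" for a t
  proof (intro conjI)
    show "(G a has_real_derivative G' a t) (at t within {0..})"
      unfolding G_def G'_def
      by (intro DERIV_diff DERIV_cdivide DERIV_cmult DERIV_mult' d at)
        (rule derivative_eq_intros refl du dw at | simp)+
    have "2 * \<bar>u a t * w a t\<bar> \<le> (u a t)\<^sup>2 + (w a t)\<^sup>2"
      using zero_le_power2[of "\<bar>u a t\<bar> - \<bar>w a t\<bar>"]
      by (simp add: power2_diff abs_mult algebra_simps)
    also have "\<dots> \<le> 2 * c * (Y a t + Z a t)" using bu[OF at] bw[OF at] by simp
    finally have 1: "2 * \<bar>u a t * w a t\<bar> \<le> 2 * c * (Y a t + Z a t)" .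
    have 2: "\<bar>F a t / \<delta>\<bar> \<le> B / \<delta> * (Y a t + Z a t)"
      using divide_right_mono[OF b[OF at], of \<delta>] \<delta> by simp
    have 3: "\<delta> * c * (Y a t + Z a t) \<ge> 0" using \<delta> c nn[OF at] by simp
    have "\<bar>G a t\<bar> \<le> \<bar>F a t / \<delta>\<bar> + 2 * \<bar>u a t * w a t\<bar>"
      unfolding G_def by linarith
    then show "\<bar>G a t\<bar> \<le> D * (Y a t + Z a t)"
      unfolding D_def distrib_right using 1 2 3 by (simp add: algebra_simps)
    have 4: "- 2 * (w' a t * u a t) \<le> \<delta> * (w' a t)\<^sup>2 + (u a t)\<^sup>2 / \<delta>"
    proof -
      have "0 \<le> (\<delta> * w' a t + u a t)\<^sup>2 / \<delta>" using \<delta> by simp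
      also have "\<dots> = \<delta> * (w' a t)\<^sup>2 + (u a t)\<^sup>2 / \<delta> + 2 * (w' a t * u a t)"
        using \<delta> by (simp add: power2_eq_square field_simps)
      finally show ?thesis by simp
    qed
    have 5: "- 2 * ((w a t + r a t) * w a t) \<le> - (w a t)\<^sup>2 + (r a t)\<^sup>2"
      using zero_le_power2[of "w a t + r a t"] by (simp add: power2_eq_square algebra_simps)
    have 6: "F' a t / \<delta> \<le> - (u a t)\<^sup>2 / \<delta> + \<epsilon> / 2 * Y a t + B / \<delta> * Z a t"
      using divide_right_mono[OF e[OF at], of \<delta>] \<delta> by (simp add: field_simps)
    have 7: "\<delta> * (w' a t)\<^sup>2 \<le> \<epsilon> / 2 * Y a t + \<delta> * c * Z a t"
    proof -
      have "\<delta> * (w' a t)\<^sup>2 \<le> \<delta> * (c * (Y a t + Z a t))"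
        using bw'[OF at] \<delta> by (intro mult_left_mono) auto
      also have "\<dots> = \<delta> * c * Y a t + \<delta> * c * Z a t" by (simp add: algebra_simps)
      also have "\<dots> \<le> \<epsilon> / 2 * Y a t + \<delta> * c * Z a t"
        using \<delta> nn[OF at] c by (intro add_mono mult_right_mono) auto
      finally show ?thesis .
    qed
    have 8: "c * Z a t \<ge> 0" using c nn[OF at] by simp
    have "G' a t = F' a t / \<delta> + (- 2 * ((w a t + r a t) * w a t)) + (- 2 * (w' a t * u a t))"
      unfolding G'_def by simp
    also have "\<dots> \<le> (- (u a t)\<^sup>2 / \<delta> + \<epsilon> / 2 * Y a t + B / \<delta> * Z a t) + (- (w a t)\<^sup>2 + (r a t)\<^sup>2)
        + (\<delta> * (w' a t)\<^sup>2 + (u a t)\<^sup>2 / \<delta>)"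
      by (intro add_mono 4 5 6)
    also have "\<dots> \<le> - (w a t)\<^sup>2 + \<epsilon> * Y a t + D * Z a t"
      unfolding D_def distrib_right using 7 br[OF at] 8 by simp
    finally show "G' a t \<le> - (w a t)\<^sup>2 + \<epsilon> * Y a t + D * Z a t" .
  qed
  then show "\<exists>B F F'. dissipates S Y Z (\<lambda>a t. (w a t)\<^sup>2) \<epsilon> B F F'"
    using D unfolding dissipates_def by (intro exI[of _ D] exI[of _ G] exI[of _ G']) simp
qed

text \<open>
  Multipliers add up without loss, because the errors are linear in \<open>Y\<close> and \<open>Z\<close>.\<close>

lemma dissipates_sum:
  assumes "finite I" "\<And>i. i \<in> I \<Longrightarrow> damped S Y Z (u i)" "\<epsilon> > 0"
    "\<And>a t. a \<in> S \<Longrightarrow> t \<ge> 0 \<Longrightarrow> 0 \<le> Y a t" "\<And>a t. a \<in> S \<Longrightarrow> t \<ge> 0 \<Longrightarrow> 0 \<le> Z a t"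
  shows "\<exists>B F F'. dissipates S Y Z (\<lambda>a t. \<Sum>i\<in>I. (u i a t)\<^sup>2) \<epsilon> B F F'"
  using assms(1-3)
proof (induction I arbitrary: \<epsilon> rule: finite_induct)
  case empty
  have "\<epsilon> * Y a t \<ge> 0" if "a \<in> S" "t \<ge> 0" for a t using assms(4)[OF that] empty by simp
  then show ?case
    by (intro exI[of _ 0] exI[of _ "\<lambda>_ _. 0"]) (auto simp: dissipates_def)
next
  case (insert i I)
  have "\<epsilon> / 2 > 0" using insert by simp
  from insert.IH[OF insert.prems(1) this] obtain B F F' where
    BF: "dissipates S Y Z (\<lambda>a t. \<Sum>i\<in>I. (u i a t)\<^sup>2) (\<epsilon> / 2) B F F'" by blast
  from insert.prems(1)[of i] \<open>\<epsilon> / 2 > 0\<close> obtain C G G' where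
    CG: "dissipates S Y Z (\<lambda>a t. (u i a t)\<^sup>2) (\<epsilon> / 2) C G G'"
    unfolding damped_def by blast
  note d1 = dissipatesD[OF BF] and d2 = dissipatesD[OF CG]
  have "dissipates S Y Z (\<lambda>a t. \<Sum>j\<in>insert i I. (u j a t)\<^sup>2) \<epsilon> (B + C)
      (\<lambda>a t. F a t + G a t) (\<lambda>a t. F' a t + G' a t)"
    unfolding dissipates_def
  proof (intro conjI ballI allI impI)
    show "B + C \<ge> 0" using d1(1) d2(1) by simp
    fix a t assume at: "a \<in> S" "(t :: real) \<ge> 0"
    show "((\<lambda>t. F a t + G a t) has_real_derivative F' a t + G' a t) (at t within {0..})"
      by (intro DERIV_add d1 d2 at)
    show "\<bar>F a t + G a t\<bar> \<le> (B + C) * (Y a t + Z a t)"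
      using d1(3)[OF at] d2(3)[OF at] by (simp add: algebra_simps)
    show "F' a t + G' a t \<le> - (\<Sum>j\<in>insert i I. (u j a t)\<^sup>2) + \<epsilon> * Y a t + (B + C) * Z a t"
      using d1(4)[OF at] d2(4)[OF at] insert.hyps by (simp add: algebra_simps)
  qed
  then show ?case by blast
qed

text \<open>
  This hides the constants of the quadratic bounds, whose values do not matter.\<close>

definition quad_bounded :: "'a set \<Rightarrow> ('a \<Rightarrow> real \<Rightarrow> real) \<Rightarrow> ('a \<Rightarrow> real \<Rightarrow> real) \<Rightarrow> bool" where
  "quad_bounded S X u \<longleftrightarrow> (\<exists>c\<ge>0. \<forall>a\<in>S. \<forall>t\<ge>0. (u a t)\<^sup>2 \<le> c * X a t)"

lemma quad_boundedE:
  assumes "quad_bounded S X u"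
  obtains c where "c \<ge> 0" "\<forall>a\<in>S. \<forall>t\<ge>0. (u a t)\<^sup>2 \<le> c * X a t"
  using assms unfolding quad_bounded_def by (elim exE conjE)

lemma quad_bounded_mono:
  assumes "quad_bounded S X u" "\<And>a t. a \<in> S \<Longrightarrow> t \<ge> 0 \<Longrightarrow> X a t \<le> X' a t"
  shows "quad_bounded S X' u"
proof (rule quad_boundedE[OF assms(1)])
  fix c assume c0: "c \<ge> 0" "\<forall>a\<in>S. \<forall>t\<ge>0. (u a t)\<^sup>2 \<le> c * X a t"
  note c = c0(1) c0(2)[rule_format]
  have "(u a t)\<^sup>2 \<le> c * X' a t" if "a \<in> S" "t \<ge> 0" for a t
    using c(2)[OF that] mult_left_mono[OF assms(2)[OF that] c(1)] by linarith
  then show ?thesis using c(1) unfolding quad_bounded_def by (intro exI[of _ c]) simp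
qed

lemma quad_bounded_scale:
  assumes "quad_bounded S X u"
  shows "quad_bounded S X (\<lambda>a t. b * u a t)"
proof -
  from assms obtain c where "c \<ge> 0" "\<forall>a\<in>S. \<forall>t\<ge>0. (u a t)\<^sup>2 \<le> c * X a t"
    by (rule quad_boundedE)
  then show ?thesis unfolding quad_bounded_def
    by (intro exI[of _ "b\<^sup>2 * c"]) (auto simp: power_mult_distrib mult.assoc intro!: mult_left_mono)
qed

lemma quad_bounded_add:
  assumes "quad_bounded S X u" "quad_bounded S X v"
  shows "quad_bounded S X (\<lambda>a t. u a t + v a t)"
proof -
  from assms(1) obtain c
    where c0: "c \<ge> 0" "\<forall>a\<in>S. \<forall>t\<ge>0. (u a t)\<^sup>2 \<le> c * X a t"
    by (rule quad_boundedE)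
  note c = c0(1) c0(2)[rule_format]
  from assms(2) obtain d
    where d0: "d \<ge> 0" "\<forall>a\<in>S. \<forall>t\<ge>0. (v a t)\<^sup>2 \<le> d * X a t"
    by (rule quad_boundedE)
  note d = d0(1) d0(2)[rule_format]
  have "(u a t + v a t)\<^sup>2 \<le> (2 * (c + d)) * X a t" if "a \<in> S" "t \<ge> 0" for a t
  proof -
    have "(u a t + v a t)\<^sup>2 \<le> 2 * (u a t)\<^sup>2 + 2 * (v a t)\<^sup>2"
      using zero_le_power2[of "u a t - v a t"] by (simp add: power2_eq_square algebra_simps)
    then show ?thesis using c(2)[OF that] d(2)[OF that] by (simp add: algebra_simps)
  qed
  then show ?thesis unfolding quad_bounded_def using c d
    by (intro exI[of _ "2 * (c + d)"]) auto
qed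

lemma damped_of_quad_bounded:
  assumes "quad_bounded S Z u"
    and "\<And>a t. a \<in> S \<Longrightarrow> t \<ge> 0 \<Longrightarrow> 0 \<le> Y a t" "\<And>a t. a \<in> S \<Longrightarrow> t \<ge> 0 \<Longrightarrow> 0 \<le> Z a t"
  shows "damped S Y Z u"
proof (rule quad_boundedE[OF assms(1)])
  fix c assume "c \<ge> 0" "\<forall>a\<in>S. \<forall>t\<ge>0. (u a t)\<^sup>2 \<le> c * Z a t"
  then show ?thesis using assms(2,3) by (intro damped_of_le[of c]) simp_all
qed

lemma damped_derivative:
  assumes "damped S Y Z u"
    and nn: "\<And>a t. a \<in> S \<Longrightarrow> t \<ge> 0 \<Longrightarrow> 0 \<le> Y a t" "\<And>a t. a \<in> S \<Longrightarrow> t \<ge> 0 \<Longrightarrow> 0 \<le> Z a t"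
    and "\<And>a t. a \<in> S \<Longrightarrow> t \<ge> 0 \<Longrightarrow> (u a has_real_derivative w a t + r a t) (at t within {0..})"
    and "\<And>a t. a \<in> S \<Longrightarrow> t \<ge> 0 \<Longrightarrow> (w a has_real_derivative w' a t) (at t within {0..})"
    and "quad_bounded S (\<lambda>a t. Y a t + Z a t) u" "quad_bounded S (\<lambda>a t. Y a t + Z a t) w"
      "quad_bounded S (\<lambda>a t. Y a t + Z a t) w'" "quad_bounded S Z r"
  shows "damped S Y Z w"
proof -
  from assms(6) obtain c1 where "c1 \<ge> 0"
    and c1: "\<forall>a\<in>S. \<forall>t\<ge>0. (u a t)\<^sup>2 \<le> c1 * (Y a t + Z a t)"
    by (rule quad_boundedE)
  from assms(7) obtain c2 where "c2 \<ge> 0"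
    and c2: "\<forall>a\<in>S. \<forall>t\<ge>0. (w a t)\<^sup>2 \<le> c2 * (Y a t + Z a t)"
    by (rule quad_boundedE)
  from assms(8) obtain c3 where "c3 \<ge> 0"
    and c3: "\<forall>a\<in>S. \<forall>t\<ge>0. (w' a t)\<^sup>2 \<le> c3 * (Y a t + Z a t)"
    by (rule quad_boundedE)
  from assms(9) obtain c4 where "c4 \<ge> 0"
    and c4: "\<forall>a\<in>S. \<forall>t\<ge>0. (r a t)\<^sup>2 \<le> c4 * Z a t"
    by (rule quad_boundedE)
  define c where "c = c1 + c2 + c3 + c4"
  have le: "c1 \<le> c" "c2 \<le> c" "c3 \<le> c" "c4 \<le> c" "c \<ge> 0"
    using \<open>c1 \<ge> 0\<close> \<open>c2 \<ge> 0\<close> \<open>c3 \<ge> 0\<close> \<open>c4 \<ge> 0\<close> by (auto simp: c_def)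
  have bound: "x \<le> c * y" if "x \<le> d * y" "d \<le> c" "y \<ge> 0" for x y d
    using mult_right_mono[OF that(2,3)] that(1) by linarith
  show ?thesis
    by (rule damped_time_derivative[OF assms(1) le(5) nn assms(4,5)])
      (assumption | rule bound[OF c1[rule_format] le(1)] bound[OF c2[rule_format] le(2)]
        bound[OF c3[rule_format] le(3)] bound[OF c4[rule_format] le(4)]
        add_nonneg_nonneg nn)+
qed

text \<open>
  The undamped part \<open>Y\<close> is here its own dissipated quantity.  With \<open>\<eta>\<close> small against \<open>B\<close> the modified energy
  \<open>en + \<eta> F\<close> is comparable to \<open>en\<close> and decreases at a rate proportional to \<open>en\<close>, so that Gronwall's
  argument applies.  Only \<open>B\<close> enters the rate, and \<open>R\<close> may contain arbitrarily many damped modes.\<close>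

lemma exponential_decay:
  assumes "dissipates S Y Z Y (1 / 2) B F F'" "a \<in> S"
    and nn: "\<And>t. t \<ge> 0 \<Longrightarrow> 0 \<le> Y a t" "\<And>t. t \<ge> 0 \<Longrightarrow> 0 \<le> Z a t" "\<And>t. t \<ge> 0 \<Longrightarrow> Z a t \<le> R t"
    and en: "\<And>t. t \<ge> 0 \<Longrightarrow> en t = Y a t + R t"
    and den: "\<And>t. t \<ge> 0 \<Longrightarrow> (en has_real_derivative - 2 * R t) (at t within {0..})"
    and \<eta>: "\<eta> = 1 / (2 * (B + 1))" and "t \<ge> 0"
  shows "en t \<le> 3 * exp (- (\<eta> / 3) * t) * en 0"
proof -
  note d = dissipatesD[OF assms(1)]
  have "\<eta> > 0" "\<eta> * B \<le> 1 / 2" "\<eta> \<le> 1 / 2"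
    using d(1) unfolding \<eta> by (auto simp: field_simps)
  define G where "G s = en s + \<eta> * F a s" for s
  have G: "en s / 2 \<le> G s" "G s \<le> 3 / 2 * en s" if "s \<ge> 0" for s
  proof -
    have "\<bar>\<eta> * F a s\<bar> \<le> (\<eta> * B) * (Y a s + Z a s)"
      using mult_left_mono[OF d(3)[OF \<open>a \<in> S\<close> that], of \<eta>] \<open>\<eta> > 0\<close>
      by (simp add: abs_mult mult.assoc)
    also have "\<dots> \<le> 1 / 2 * (Y a s + R s)"
      using \<open>\<eta> * B \<le> 1 / 2\<close> nn[OF that] by (intro mult_mono) auto
    finally have "\<bar>\<eta> * F a s\<bar> \<le> en s / 2" using en[OF that] by simp
    then show "en s / 2 \<le> G s" "G s \<le> 3 / 2 * en s"
      unfolding G_def by linarith+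
  qed
  define H where "H s = exp (\<eta> / 3 * s) * G s" for s
  have dG: "\<exists>y. (G has_real_derivative y) (at s within {0..}) \<and> y \<le> - (\<eta> / 3) * G s" if "s \<ge> 0" for s
  proof (intro exI conjI)
    show "(G has_real_derivative - 2 * R s + \<eta> * F' a s) (at s within {0..})"
      unfolding G_def by (intro DERIV_add DERIV_cmult den d \<open>a \<in> S\<close> that)
    have "\<eta> * F' a s \<le> \<eta> * (- Y a s + 1 / 2 * Y a s + B * Z a s)"
      using d(4)[OF \<open>a \<in> S\<close> that] \<open>\<eta> > 0\<close> by (intro mult_left_mono) auto
    also have "\<dots> = - (\<eta> / 2 * Y a s) + (\<eta> * B) * Z a s" by (simp add: algebra_simps)
    also have "(\<eta> * B) * Z a s \<le> 1 / 2 * R s"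
      using \<open>\<eta> * B \<le> 1 / 2\<close> nn[OF that] by (intro mult_mono) auto
    finally have 1: "\<eta> * F' a s \<le> - (\<eta> / 2 * Y a s) + 1 / 2 * R s" by simp
    have 2: "\<eta> / 2 * R s \<le> R s"
      using mult_right_mono[of "\<eta> / 2" 1 "R s"] \<open>\<eta> \<le> 1 / 2\<close> nn[OF that] by simp
    have 4: "R s \<ge> 0" using nn[OF that] by simp
    have 3: "\<eta> / 3 * G s \<le> \<eta> / 3 * (3 / 2 * en s)"
      using G(2)[OF that] \<open>\<eta> > 0\<close> by (intro mult_left_mono) auto
    have "\<eta> / 3 * (3 / 2 * en s) = \<eta> / 2 * Y a s + \<eta> / 2 * R s"
      using en[OF that] by (simp add: algebra_simps)
    then show "- 2 * R s + \<eta> * F' a s \<le> - (\<eta> / 3) * G s"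
      using 1 2 3 4 by linarith
  qed
  have dH: "\<exists>y. (H has_real_derivative y) (at s within {0..}) \<and> y \<le> 0" if s: "s \<ge> 0" for s
  proof -
    obtain y where y: "(G has_real_derivative y) (at s within {0..})" "y \<le> - (\<eta> / 3) * G s"
      using dG[OF s] by blast
    have "(H has_real_derivative exp (\<eta> / 3 * s) * y + exp (\<eta> / 3 * s) * (\<eta> / 3) * G s) (at s within {0..})"
      unfolding H_def by (rule derivative_eq_intros refl y | simp)+
    moreover have "exp (\<eta> / 3 * s) * y + exp (\<eta> / 3 * s) * (\<eta> / 3) * G s
        = exp (\<eta> / 3 * s) * (y + \<eta> / 3 * G s)" by (simp add: algebra_simps)
    moreover have "\<dots> \<le> 0" using y(2) by (intro mult_nonneg_nonpos) auto
    ultimately show ?thesis by auto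
  qed
  have "H t \<le> H 0"
  proof (rule DERIV_nonpos_imp_decreasing_open[OF \<open>t \<ge> 0\<close>])
    fix s :: real assume "0 < s" "s < t"
    moreover have "at s within {0..} = at s"
      using \<open>0 < s\<close> by (intro at_within_interior) simp
    ultimately show "\<exists>y. DERIV H s :> y \<and> y \<le> 0" using dH[of s] by auto
  next
    have "continuous_on {0..} H"
      unfolding continuous_on_eq_continuous_within using dH DERIV_continuous by fastforce
    then show "continuous_on {0..t} H" by (rule continuous_on_subset) auto
  qed
  then have "exp (\<eta> / 3 * t) * G t \<le> G 0" by (simp add: H_def)
  then have "G t \<le> exp (- (\<eta> / 3) * t) * G 0"
    by (simp add: exp_minus field_simps)
  also have "\<dots> \<le> exp (- (\<eta> / 3) * t) * (3 / 2 * en 0)"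
    using G(2)[of 0] by (intro mult_left_mono) auto
  finally show ?thesis using G(1)[OF \<open>t \<ge> 0\<close>] by simp
qed

section \<open>Orthonormal polynomials for an exponential weight\<close>

lemma poly_measurable [measurable]: "poly (p :: real poly) \<in> borel_measurable borel"
  by (intro borel_measurable_continuous_onI continuous_at_imp_continuous_on ballI poly_isCont)

lemma rho_measurable [measurable]: "rho \<phi> \<in> borel_measurable borel"
  unfolding rho_def [abs_def] by measurable

lemma rho_pos: "rho \<phi> x > 0"
  by (simp add: rho_def)

text \<open>
  The bound is \<open>\<bar>f g\<bar> \<le> f\<^sup>2 + g\<^sup>2\<close>.\<close>

lemma integrable_weighted_product:
  fixes f g w :: "'a \<Rightarrow> real"
  assumes "integrable M (\<lambda>x. f x * f x * w x)" "integrable M (\<lambda>x. g x * g x * w x)"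
    and "\<And>x. w x \<ge> 0"
    and [measurable]: "f \<in> borel_measurable M" "g \<in> borel_measurable M" "w \<in> borel_measurable M"
  shows "integrable M (\<lambda>x. f x * g x * w x)"
proof (rule Bochner_Integration.integrable_bound)
  show "integrable M (\<lambda>x. f x * f x * w x + g x * g x * w x)"
    using assms by simp
  have "\<bar>f x * g x * w x\<bar> \<le> f x * f x * w x + g x * g x * w x" for x
  proof -
    have "\<bar>f x * g x\<bar> \<le> f x * f x + g x * g x"
      using zero_le_power2[of "f x - g x"] zero_le_power2[of "f x + g x"]
      by (simp add: power2_eq_square algebra_simps abs_le_iff)
    then have "\<bar>f x * g x\<bar> * w x \<le> (f x * f x + g x * g x) * w x"
      using assms(3) by (intro mult_right_mono) auto
    then show ?thesis using assms(3)[of x] by (simp add: abs_mult algebra_simps)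
  qed
  then show "AE x in M. norm (f x * g x * w x) \<le> norm (f x * f x * w x + g x * g x * w x)"
    by (intro AE_I2) (smt (verit) real_norm_def)
qed measurable

lemma poly_graded_span:
  fixes Q :: "nat \<Rightarrow> real poly"
  assumes "\<And>n. degree (Q n) = n" "\<And>n. lead_coeff (Q n) \<noteq> 0" "degree p \<le> d"
  shows "\<exists>a. p = (\<Sum>j\<le>d. smult (a j) (Q j))"
  using assms(3)
proof (induction d arbitrary: p)
  case 0
  define a where "a = coeff p 0 / coeff (Q 0) 0"
  have "coeff (Q 0) 0 \<noteq> 0" using assms(1)[of 0] assms(2)[of 0] by simp
  moreover have "p = [:coeff p 0:]" "Q 0 = [:coeff (Q 0) 0:]"
    using 0 assms(1)[of 0] by (metis coeff_pCons_0 degree_eq_zeroE le_zero_eq)+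
  ultimately have "p = smult a (Q 0)"
    unfolding a_def by (metis nonzero_eq_divide_eq smult_0_right smult_pCons)
  then show ?case by (intro exI[of _ "\<lambda>_. a"]) simp
next
  case (Suc d)
  define c where "c = coeff p (Suc d) / coeff (Q (Suc d)) (Suc d)"
  define q where "q = p - smult c (Q (Suc d))"
  have "coeff (Q (Suc d)) (Suc d) \<noteq> 0" using assms(1)[of "Suc d"] assms(2)[of "Suc d"] by simp
  then have "coeff q (Suc d) = 0" by (simp add: q_def c_def)
  moreover have "degree q \<le> Suc d"
    unfolding q_def using Suc.prems assms(1)[of "Suc d"]
    by (intro degree_diff_le) (auto intro: order.trans[OF degree_smult_le])
  ultimately have "degree q \<le> d"
    by (metis coeff_0_degree_minus_1 diff_Suc_1 le_SucE le_zero_eq nat_le_linear not0_implies_Suc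
        degree_le eq_zero_or_degree_less less_Suc_eq_le coeff_eq_0 linorder_not_le)
  then obtain a where "q = (\<Sum>j\<le>d. smult (a j) (Q j))" using Suc.IH by blast
  then have "p = (\<Sum>j\<le>Suc d. smult ((a(Suc d := c)) j) (Q j))"
    by (simp add: q_def algebra_simps)
  then show ?case by blast
qed

lemma tendsto_poly_exp_minus:
  fixes p :: "real poly"
  shows "((\<lambda>x. poly p x * exp (- x)) \<longlongrightarrow> 0) at_top"
proof -
  have "((\<lambda>x. \<Sum>i\<le>degree p. coeff p i * (x ^ i / exp x)) \<longlongrightarrow> (\<Sum>i\<le>degree p. coeff p i * 0)) at_top"
    by (intro tendsto_intros tendsto_power_div_exp_0)
  then show ?thesis
    by (simp add: poly_altdef sum_distrib_right exp_minus divide_inverse mult.assoc)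
qed

definition mean :: "real poly \<Rightarrow> real poly \<Rightarrow> real" where
  "mean \<phi> p = avg \<phi> (poly p)"

locale orthonormal_potential =
  fixes \<phi> :: "real poly" and P :: "nat \<Rightarrow> real poly"
  assumes potential: "potential \<phi>"
    and orthonormal: "orthonormal_polys (rho \<phi>) P"
begin

abbreviation E :: "real poly \<Rightarrow> real" where "E \<equiv> mean \<phi>"

lemma degree_P: "degree (P n) = n"
  using orthonormal unfolding orthonormal_polys_def by auto

lemma lead_P: "lead_coeff (P n) > 0"
  using orthonormal unfolding orthonormal_polys_def by blast

lemma P_integral: "(LINT x|lborel. poly (P m) x * poly (P n) x * rho \<phi> x) = (if m = n then 1 else 0)"
  using orthonormal unfolding orthonormal_polys_def by auto

lemma span: "degree p \<le> d \<Longrightarrow> \<exists>a. p = (\<Sum>j\<le>d. smult (a j) (P j))"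
  by (rule poly_graded_span) (use degree_P less_imp_neq[OF lead_P] in auto)

text \<open>
  Integrability is contained in the normalization: a function that is not integrable has integral 0 by
  convention, whereas \<open>(P n)\<^sup>2\<close> has integral 1.\<close>

lemma integrable_PP: "integrable lborel (\<lambda>x. poly (P m) x * poly (P n) x * rho \<phi> x)"
proof -
  have square: "integrable lborel (\<lambda>x. poly (P k) x * poly (P k) x * rho \<phi> x)" for k
    using P_integral[of k k] not_integrable_integral_eq by fastforce
  show ?thesis
    by (rule integrable_weighted_product[OF square square])
      (auto simp: less_imp_le[OF rho_pos])
qed

lemma integrable_P: "integrable lborel (\<lambda>x. poly (P n) x * rho \<phi> x)"
proof -
  obtain c where c: "P 0 = [:c:]" using degree_P[of 0] by (rule degree_eq_zeroE)
  have "c \<noteq> 0" using lead_P[of 0] c by simp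
  have "integrable lborel (\<lambda>x. 1 / c * (poly (P n) x * poly (P 0) x * rho \<phi> x))"
    by (intro integrable_mult_right integrable_PP)
  then show ?thesis using \<open>c \<noteq> 0\<close> by (simp add: c)
qed

lemma integrable_poly: "integrable lborel (\<lambda>x. poly p x * rho \<phi> x)"
proof -
  have sum: "integrable lborel (\<lambda>x. poly (\<Sum>j\<in>A. smult (b j) (P j)) x * rho \<phi> x)" for A b
  proof (induction A rule: infinite_finite_induct)
    case (insert j A)
    have "integrable lborel (\<lambda>x. b j * (poly (P j) x * rho \<phi> x) +
        poly (\<Sum>j\<in>A. smult (b j) (P j)) x * rho \<phi> x)"
      by (intro Bochner_Integration.integrable_add integrable_mult_right integrable_P insert.IH)
    then show ?case using insert.hyps by (simp add: distrib_right mult.assoc)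
  qed auto
  obtain d where "degree p \<le> d" by blast
  from span[OF this] obtain a where a: "p = (\<Sum>j\<le>d. smult (a j) (P j))" by (elim exE)
  show ?thesis unfolding a by (rule sum)
qed

lemma E_add: "E (p + q) = E p + E q"
  unfolding mean_def avg_def poly_add distrib_right
  by (rule Bochner_Integration.integral_add) (rule integrable_poly)+

lemma E_smult: "E (smult c p) = c * E p"
  unfolding mean_def avg_def poly_smult mult.assoc by (rule integral_mult_right_zero)

lemma E_0: "E 0 = 0"
  unfolding mean_def avg_def by simp

lemma E_minus: "E (- p) = - E p"
  using E_smult[of "-1" p] by simp

lemma E_diff: "E (p - q) = E p - E q"
  using E_add[of p "- q"] E_minus by simp

lemma E_sum: "E (\<Sum>i\<in>A. f i) = (\<Sum>i\<in>A. E (f i))"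
  by (induction A rule: infinite_finite_induct) (simp_all add: E_add E_0)

lemmas E_linear = E_add E_diff E_minus E_smult E_0 E_sum

lemma ip_poly: "ip \<phi> (poly p) (poly q) = E (p * q)"
  by (simp add: ip_def mean_def avg_def)

lemma E_PP: "E (P m * P n) = (if m = n then 1 else 0)"
  using P_integral by (simp add: mean_def avg_def)

lemma E_1: "E 1 = 1"
  using potential by (simp add: potential_def mean_def avg_def)

lemma expand:
  assumes "degree f \<le> N"
  shows "f = (\<Sum>n\<le>N. smult (E (f * P n)) (P n))"
proof -
  obtain a where a: "f = (\<Sum>j\<le>N. smult (a j) (P j))"
    using span[OF assms] by (elim exE)
  have "E (f * P n) = a n" if "n \<le> N" for n
  proof -
    have "E (f * P n) = (\<Sum>j\<le>N. a j * E (P j * P n))"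
      by (subst a) (simp add: sum_distrib_right E_linear)
    also have "\<dots> = a n" using that by (simp add: E_PP if_distrib sum.delta cong: if_cong)
    finally show ?thesis .
  qed
  then have "(\<Sum>n\<le>N. smult (E (f * P n)) (P n)) = (\<Sum>n\<le>N. smult (a n) (P n))"
    by (intro sum.cong) auto
  then show ?thesis using a by simp
qed

lemma parseval:
  assumes "degree f \<le> N"
  shows "E (f * g) = (\<Sum>n\<le>N. E (f * P n) * E (g * P n))"
proof -
  have "E (f * g) = E ((\<Sum>n\<le>N. smult (E (f * P n)) (P n)) * g)"
    using expand[OF assms] by simp
  then show ?thesis by (simp add: sum_distrib_left sum_distrib_right E_linear mult.commute)
qed

lemma E_square_pos:
  assumes "f \<noteq> 0"
  shows "E (f * f) > 0"
proof -
  have "E (f * f) = (\<Sum>n\<le>degree f. (E (f * P n))\<^sup>2)"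
    using parseval[of f "degree f" f] by (simp add: power2_eq_square)
  moreover have "\<exists>n\<le>degree f. E (f * P n) \<noteq> 0"
  proof (rule ccontr)
    assume "\<not> ?thesis"
    then have "f = 0" using expand[of f "degree f"] by simp
    then show False using assms by simp
  qed
  ultimately show ?thesis
    by (auto intro!: sum_pos2)
qed

text \<open>
  Since the degree of \<open>\<phi>\<close> is at least 2, the potential exceeds \<open>x\<close> for large \<open>x\<close>, and \<open>exp (- x)\<close> beats every
  polynomial; evenness transfers this to the other end.\<close>

lemma tendsto_poly_rho:
  shows "((\<lambda>x. poly p x * rho \<phi> x) \<longlongrightarrow> 0) at_top" (is ?top)
    and "((\<lambda>x. poly p x * rho \<phi> x) \<longlongrightarrow> 0) at_bot" (is ?bot)
proof -
  have *: "((\<lambda>x. poly q x * rho \<phi> x) \<longlongrightarrow> 0) at_top" for q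
  proof -
    have deg: "degree (- [:0, 1:] :: real poly) < degree \<phi>"
      using potential by (auto simp: potential_def)
    have "lead_coeff (- [:0, 1:] + \<phi>) = lead_coeff \<phi>"
      using deg by (rule lead_coeff_add_le)
    then have "lead_coeff (- [:0, 1:] + \<phi>) > 0"
      using potential by (simp add: potential_def)
    from poly_pinfty_gt_lc[OF this] this obtain n where n: "\<And>x. x \<ge> n \<Longrightarrow> poly \<phi> x \<ge> x"
      by force
    show ?thesis
    proof (rule Lim_null_comparison)
      have "norm (poly q x * rho \<phi> x) \<le> \<bar>poly q x * exp (- x)\<bar>" if "x \<ge> n" for x
        using n[OF that] unfolding abs_mult real_norm_def rho_def by (intro mult_left_mono) auto
      then show "\<forall>\<^sub>F x in at_top. norm (poly q x * rho \<phi> x) \<le> \<bar>poly q x * exp (- x)\<bar>"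
        unfolding eventually_at_top_linorder by blast
      show "((\<lambda>x. \<bar>poly q x * exp (- x)\<bar>) \<longlongrightarrow> 0) at_top"
        using tendsto_rabs[OF tendsto_poly_exp_minus[of q]] by simp
    qed
  qed
  show ?top by (rule *)
  have even: "poly \<phi> (- x) = poly \<phi> x" for x
    using potential by (simp add: potential_def)
  show ?bot
    using *[of "pcompose p [:0, -1:]"] unfolding filterlim_at_bot_mirror
    by (simp add: poly_pcompose rho_def even)
qed

text \<open>
  The integral of the derivative of \<open>p \<rho>\<close> vanishes, because \<open>p \<rho>\<close> tends to 0 at both ends.\<close>

lemma integration_by_parts: "E (pderiv p) = E (pderiv \<phi> * p)"
proof -
  define q where "q = pderiv p - pderiv \<phi> * p"
  have "(LBINT x=-\<infinity>..\<infinity>. poly q x * rho \<phi> x) = 0 - 0"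
  proof (rule interval_integral_FTC_integrable)
    show "((\<lambda>x. poly p x * rho \<phi> x) has_vector_derivative poly q x * rho \<phi> x) (at x)" for x
      unfolding has_real_derivative_iff_has_vector_derivative[symmetric] rho_def
      by (rule derivative_eq_intros refl poly_DERIV | simp add: q_def algebra_simps)+
    show "isCont (\<lambda>x. poly q x * rho \<phi> x) x" for x
      unfolding rho_def by (intro continuous_intros poly_isCont)
    show "set_integrable lborel (einterval (- \<infinity>) \<infinity>) (\<lambda>x. poly q x * rho \<phi> x)"
      using integrable_poly[of q] by (simp add: set_integrable_def)
    show "(((\<lambda>x. poly p x * rho \<phi> x) \<circ> real_of_ereal) \<longlongrightarrow> 0) (at_right (- \<infinity>))"
      using tendsto_poly_rho(2)[of p] unfolding ereal_tendsto_simps .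
    show "(((\<lambda>x. poly p x * rho \<phi> x) \<circ> real_of_ereal) \<longlongrightarrow> 0) (at_left \<infinity>)"
      using tendsto_poly_rho(1)[of p] unfolding ereal_tendsto_simps .
  qed simp
  then have "E q = 0"
    by (simp add: interval_lebesgue_integral_def set_lebesgue_integral_def mean_def avg_def)
  then show ?thesis by (simp add: q_def E_linear)
qed

lemma E_odd:
  assumes "\<And>x. poly p (- x) = - poly p x"
  shows "E p = 0"
proof -
  have even: "poly \<phi> (- x) = poly \<phi> x" for x
    using potential by (simp add: potential_def)
  have "E p = (LINT x|lborel. poly p (0 + (-1) * x) * rho \<phi> (0 + (-1) * x))"
    unfolding mean_def avg_def by (subst lborel_integral_real_affine[where c = "-1" and t = 0]) auto
  also have "\<dots> = - E p" by (simp add: assms rho_def even mean_def avg_def)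
  finally show ?thesis by simp
qed

text \<open>
  This is the adjoint of the derivative with respect to the weight \<open>\<rho>\<close>.  It raises the degree, so on the
  polynomials of degree at most \<open>N\<close> the matrix in the scheme represents only its compression; the next
  lemmas therefore test it against polynomials of low degree.\<close>

definition adj :: "real poly \<Rightarrow> real poly" where
  "adj f = pderiv \<phi> * f - pderiv f"

lemma E_adj: "E (adj f * g) = E (f * pderiv g)"
  using integration_by_parts[of "f * g"] 
  by (simp add: adj_def pderiv_mult algebra_simps E_linear)

text \<open>
  The degree is cut off at \<open>N\<close> so that the map is linear and is given by one finite sum.\<close>

definition antideriv :: "nat \<Rightarrow> real poly \<Rightarrow> real poly" where
  "antideriv N p = (\<Sum>i\<le>N. monom (coeff p i / real (Suc i)) (Suc i))"

lemma antideriv_sum_smult: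
  "antideriv N (\<Sum>n\<in>A. smult (a n) (f n)) = (\<Sum>n\<in>A. smult (a n) (antideriv N (f n)))"
proof (rule poly_eqI)
  fix k
  define w where "w i = (if Suc i = k then 1 / real (Suc i) else 0)" for i
  have w: "coeff (antideriv N p) k = (\<Sum>i\<le>N. w i * coeff p i)" for p
    unfolding antideriv_def coeff_sum w_def by (intro sum.cong) auto
  have "(\<Sum>i\<le>N. w i * (\<Sum>n\<in>A. a n * coeff (f n) i)) =
      (\<Sum>n\<in>A. a n * (\<Sum>i\<le>N. w i * coeff (f n) i))"
    unfolding sum_distrib_left by (subst sum.swap) (simp add: mult.left_commute)
  then show "coeff (antideriv N (\<Sum>n\<in>A. smult (a n) (f n))) k =
      coeff (\<Sum>n\<in>A. smult (a n) (antideriv N (f n))) k"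
    by (simp add: w coeff_sum)
qed

lemma antideriv_pderiv:
  assumes "degree p \<le> Suc N"
  shows "antideriv N (pderiv p) = p - [:coeff p 0:]"
proof (rule poly_eqI)
  fix k
  show "coeff (antideriv N (pderiv p)) k = coeff (p - [:coeff p 0:]) k"
  proof (cases k)
    case 0
    then show ?thesis by (simp add: antideriv_def coeff_sum)
  next
    case (Suc j)
    have "coeff (antideriv N (pderiv p)) k = (\<Sum>i\<le>N. if i = j then coeff p (Suc i) else 0)"
      unfolding antideriv_def coeff_sum using Suc
      by (intro sum.cong) (auto simp: coeff_pderiv)
    also have "\<dots> = coeff p k"
      using assms Suc by (auto simp: coeff_eq_0)
    finally show ?thesis using Suc by simp
  qed
qed

text \<open>
  Every mean-free \<open>f\<close> lies in the range of the compressed adjoint.  The reason is that the derivative has a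
  right inverse: the required \<open>g\<close> represents the functional sending \<open>h\<close> to the product of \<open>f\<close> with the
  antiderivative of \<open>h\<close>, and the constant of integration is invisible to a mean-free \<open>f\<close>.\<close>

lemma adj_surj:
  assumes "E f = 0"
  obtains g where "degree g \<le> N" "\<And>h. degree h \<le> N \<Longrightarrow> E (adj g * h) = E (f * h)"
proof -
  define g where "g = (\<Sum>n\<le>N. smult (E (f * antideriv N (P n))) (P n))"
  have "degree g \<le> N" unfolding g_def
    by (intro degree_sum_le) (auto simp: degree_P intro: order.trans[OF degree_smult_le])
  moreover have "E (adj g * h) = E (f * h)" if h: "degree h \<le> N" for h
  proof -
    have dh: "degree (pderiv h) \<le> N" using h by (simp add: degree_pderiv)
    have "E (adj g * h) = E (pderiv h * g)" by (simp only: E_adj mult.commute[of g])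
    also have "\<dots> = (\<Sum>n\<le>N. E (pderiv h * P n) * E (f * antideriv N (P n)))"
      by (simp add: g_def sum_distrib_left E_linear mult.commute)
    also have "\<dots> = E (f * (\<Sum>n\<le>N. smult (E (pderiv h * P n)) (antideriv N (P n))))"
      by (simp add: sum_distrib_left E_linear)
    also have "\<dots> = E (f * antideriv N (pderiv h))"
      unfolding antideriv_sum_smult[symmetric] expand[OF dh, symmetric] ..
    also have "\<dots> = E (f * h)"
      using h assms by (simp add: antideriv_pderiv right_diff_distrib E_linear)
    finally show ?thesis .
  qed
  ultimately show ?thesis using that by blast
qed

end

text \<open>
  Uniqueness is needed because the constants of the decay estimate are chosen before the basis.\<close>

lemma orthonormal_polys_unique:
  assumes "potential \<phi>" "orthonormal_polys (rho \<phi>) P" "orthonormal_polys (rho \<phi>) Q"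
  shows "P = Q"
proof
  fix n
  interpret P: orthonormal_potential \<phi> P using assms by unfold_locales
  interpret Q: orthonormal_potential \<phi> Q using assms by unfold_locales
  have orth: "P.E (P n * Q j) = 0" if "j < n" for j
  proof -
    have "P.E (P n * Q j) = (\<Sum>i\<le>j. P.E (Q j * P i) * P.E (P n * P i))"
      using P.parseval[of "Q j" j "P n"] Q.degree_P by (simp add: mult.commute)
    also have "\<dots> = 0" using that by (intro sum.neutral) (auto simp: P.E_PP)
    finally show ?thesis .
  qed
  define a where "a = P.E (P n * Q n)"
  have "P n = (\<Sum>j\<le>n. smult (P.E (P n * Q j)) (Q j))"
    using Q.expand[of "P n" n] P.degree_P by simp
  also have "\<dots> = (\<Sum>j\<le>n. if j = n then smult a (Q n) else 0)"
    using orth by (intro sum.cong) (auto simp: a_def)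
  finally have PQ: "P n = smult a (Q n)" by simp
  have "a * a = 1" using P.E_PP[of n n] by (simp add: PQ P.E_linear Q.E_PP)
  moreover have "a > 0"
    using P.lead_P[of n] Q.lead_P[of n] by (auto simp: PQ zero_less_mult_iff split: if_splits)
  ultimately have "a = 1"
    by (metis power2_eq_square power2_eq_1_iff less_minus_one_simps(1) order_less_asym)
  then show "P n = Q n" using PQ by simp
qed

section \<open>Moments of the scheme and the generation of damped observables\<close>

context orthonormal_potential begin

text \<open>
  For coefficients \<open>C\<close> this is the inner product of \<open>f\<close> with the polynomial whose coefficients are those of
  level \<open>k\<close>.  Using moments against arbitrary test polynomials instead of coefficients moves all
  computations to the test polynomials, where they are identities for \<open>adj\<close> and \<open>pderiv\<close>.\<close>

definition moment :: "nat \<Rightarrow> nat \<Rightarrow> real poly \<Rightarrow> (nat \<Rightarrow> nat \<Rightarrow> real \<Rightarrow> real) \<Rightarrow> real \<Rightarrow> real" where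
  "moment N k f C t = (\<Sum>n\<le>N. E (f * P n) * C k n t)"

lemma moment_add: "moment N k (f + g) C t = moment N k f C t + moment N k g C t"
  by (simp add: moment_def distrib_right E_linear sum.distrib)

lemma moment_smult: "moment N k (smult c f) C t = c * moment N k f C t"
  by (simp add: moment_def E_linear sum_distrib_left mult.assoc)

lemma moment_0: "moment N k 0 C t = 0"
  by (simp add: moment_def E_linear)

lemma moment_minus: "moment N k (- f) C t = - moment N k f C t"
  using moment_smult[of N k "-1" f] by simp

lemma moment_diff: "moment N k (f - g) C t = moment N k f C t - moment N k g C t"
  using moment_add[of N k f "- g"] by (simp add: moment_minus)

lemmas moment_linear = moment_add moment_diff moment_minus moment_smult moment_0

lemma moment_cong:
  assumes "\<And>h. degree h \<le> N \<Longrightarrow> E (f * h) = E (g * h)"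
  shows "moment N k f = moment N k g"
  by (intro ext) (simp add: moment_def assms degree_P)

lemma moment_P: "n \<le> N \<Longrightarrow> moment N k (P n) C t = C k n t"
  by (simp add: moment_def E_PP if_distrib [of "\<lambda>x. x * _"] cong: if_cong)

text \<open>
  The orthogonal projection onto polynomials of degree at most \<open>N\<close>, which is all that a moment depends on.\<close>

definition proj :: "nat \<Rightarrow> real poly \<Rightarrow> real poly" where
  "proj N f = (\<Sum>n\<le>N. smult (E (f * P n)) (P n))"

lemma degree_proj: "degree (proj N f) \<le> N"
  unfolding proj_def
  by (intro degree_sum_le) (auto simp: degree_P intro: order.trans[OF degree_smult_le])

lemma E_proj:
  assumes "degree h \<le> N"
  shows "E (proj N f * h) = E (f * h)"
proof -
  have "E (proj N f * h) = (\<Sum>n\<le>N. E (h * P n) * E (f * P n))"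
    by (simp add: proj_def sum_distrib_left sum_distrib_right E_linear mult.commute)
  also have "\<dots> = E (f * h)" using parseval[OF assms, of f] by (simp add: mult.commute)
  finally show ?thesis .
qed

lemma moment_proj: "moment N k (proj N f) = moment N k f"
  by (rule moment_cong) (rule E_proj)

definition flow_rhs :: "nat \<Rightarrow> nat \<Rightarrow> nat \<Rightarrow> (nat \<Rightarrow> nat \<Rightarrow> real \<Rightarrow> real) \<Rightarrow> real \<Rightarrow> real" where
  "flow_rhs N k n C t =
     sqrt (real (k + 1)) * (\<Sum>r\<le>N. E (P r * pderiv (P n)) * C (k + 1) r t)
     - sqrt (real k) * (\<Sum>r\<le>N. E (P n * pderiv (P r)) * (if k = 0 then 0 else C (k - 1) r t))
     - (if k \<ge> 3 then 1 else 0) * C k n t"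

text \<open>
  In terms of test polynomials the scheme is the untruncated one: level \<open>k + 1\<close> is tested with the derivative
  and level \<open>k - 1\<close> with the adjoint.  The degree bound makes \<open>f\<close> a combination of the basis polynomials, and
  no derivative of these leaves the truncation.\<close>

lemma sum_flow_rhs:
  assumes "degree f \<le> N"
  shows "(\<Sum>n\<le>N. E (f * P n) * flow_rhs N k n C t) =
    sqrt (real (k + 1)) * moment N (k + 1) (pderiv f) C t
    - sqrt (real k) * (if k = 0 then 0 else moment N (k - 1) (adj f) C t)
    - (if k \<ge> 3 then 1 else 0) * moment N k f C t"
proof -
  have up: "(\<Sum>n\<le>N. E (f * P n) * (\<Sum>r\<le>N. E (P r * pderiv (P n)) * C (k + 1) r t))
      = moment N (k + 1) (pderiv f) C t"
  proof -
    have "pderiv f = (\<Sum>n\<le>N. smult (E (f * P n)) (pderiv (P n)))"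
      using arg_cong[OF expand[OF assms], of pderiv]
      unfolding higher_pderiv_sum[of 1, simplified] pderiv_smult .
    then have *: "E (pderiv f * P r) = (\<Sum>n\<le>N. E (f * P n) * E (P r * pderiv (P n)))" for r
      by (simp only: sum_distrib_right E_linear mult_smult_left mult.commute[of "P r"])
    show ?thesis
      unfolding moment_def * sum_distrib_left sum_distrib_right
      by (subst sum.swap) (simp add: mult.assoc)
  qed
  have down: "(\<Sum>n\<le>N. E (f * P n) * (\<Sum>r\<le>N. E (P n * pderiv (P r)) * D r))
      = (\<Sum>r\<le>N. E (adj f * P r) * D r)" for D
  proof -
    have *: "E (adj f * P r) = (\<Sum>n\<le>N. E (f * P n) * E (P n * pderiv (P r)))" for r
      using trans[OF E_adj parseval[OF assms], of "P r"] by (simp only: mult.commute[of "pderiv (P r)"])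
    show ?thesis
      unfolding * sum_distrib_left sum_distrib_right
      by (subst sum.swap) (simp add: mult.assoc)
  qed
  have split: "(\<Sum>n\<le>N. x n * (a * U n - b * V n - d * W n)) =
      a * (\<Sum>n\<le>N. x n * U n) - b * (\<Sum>n\<le>N. x n * V n) - d * (\<Sum>n\<le>N. x n * W n)"
    for x U V W :: "nat \<Rightarrow> real" and a b d :: real
    by (simp add: sum_distrib_left sum_subtractf sum.distrib algebra_simps)
  show ?thesis
    unfolding flow_rhs_def split up down by (cases "k = 0") (simp_all add: moment_def)
qed

lemma moment_deriv:
  assumes "\<And>n. n \<le> N \<Longrightarrow> (C k n has_real_derivative flow_rhs N k n C t) (at t within {0..})"
    and "degree f \<le> N"
  shows "(moment N k f C has_real_derivative
    sqrt (real (k + 1)) * moment N (k + 1) (pderiv f) C t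
    - sqrt (real k) * (if k = 0 then 0 else moment N (k - 1) (adj f) C t)
    - (if k \<ge> 3 then 1 else 0) * moment N k f C t) (at t within {0..})"
proof -
  have "(moment N k f C has_real_derivative (\<Sum>n\<le>N. E (f * P n) * flow_rhs N k n C t)) (at t within {0..})"
    unfolding moment_def [abs_def] by (intro DERIV_sum DERIV_cmult assms(1)) simp
  then show ?thesis unfolding sum_flow_rhs[OF assms(2)] .
qed

definition level :: "nat \<Rightarrow> nat \<Rightarrow> (nat \<Rightarrow> nat \<Rightarrow> real \<Rightarrow> real) \<Rightarrow> real \<Rightarrow> real" where
  "level N k C t = (\<Sum>n\<le>N. (C k n t)\<^sup>2)"

lemma level_nonneg: "level N k C t \<ge> 0"
  by (simp add: level_def sum_nonneg)

lemma moment_quad_bounded: "quad_bounded S (level N k) (moment N k f)"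
  unfolding quad_bounded_def moment_def level_def
  by (intro exI[of _ "\<Sum>n\<le>N. (E (f * P n))\<^sup>2"] conjI ballI allI impI Cauchy_Schwarz_ineq_sum)
    (simp add: sum_nonneg)

definition low :: "nat \<Rightarrow> (nat \<Rightarrow> nat \<Rightarrow> real \<Rightarrow> real) \<Rightarrow> real \<Rightarrow> real" where
  "low N C t = level N 0 C t + level N 1 C t + level N 2 C t"

definition high :: "nat \<Rightarrow> (nat \<Rightarrow> nat \<Rightarrow> real \<Rightarrow> real) \<Rightarrow> real \<Rightarrow> real" where
  "high N C t = level N 3 C t + level N 4 C t"

lemma low_nonneg: "low N C t \<ge> 0" and high_nonneg: "high N C t \<ge> 0"
  by (simp_all add: low_def high_def level_nonneg)

lemma moment_bounded:
  assumes "k \<le> 4"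
  shows "quad_bounded S (\<lambda>C t. low N C t + high N C t) (moment N k f)"
proof (rule quad_bounded_mono[OF moment_quad_bounded])
  fix C t
  have "k \<in> {0, 1, 2, 3, 4}" using assms by auto
  then show "level N k C t \<le> low N C t + high N C t"
    using level_nonneg[of N 0 C t] level_nonneg[of N 1 C t] level_nonneg[of N 2 C t]
      level_nonneg[of N 3 C t] level_nonneg[of N 4 C t]
    unfolding low_def high_def by auto
qed

lemma moment_high_bounded:
  assumes "k = 3 \<or> k = 4"
  shows "quad_bounded S (high N) (moment N k f)"
proof (rule quad_bounded_mono[OF moment_quad_bounded])
  fix C t
  show "level N k C t \<le> high N C t"
    using assms level_nonneg[of N 3 C t] level_nonneg[of N 4 C t] unfolding high_def by auto
qed

text \<open>
  The number of velocity modes does not occur: only the equations of the levels 0 to 3 matter for the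
  multiplier, and level 4 enters them as a damped source.  This makes the rate independent of that number.\<close>

definition flows :: "nat \<Rightarrow> (nat \<Rightarrow> nat \<Rightarrow> real \<Rightarrow> real) set" where
  "flows N = {C. (\<forall>k\<le>3. \<forall>n\<le>N. \<forall>t\<ge>0.
       (C k n has_real_derivative flow_rhs N k n C t) (at t within {0..})) \<and>
     (\<forall>t\<ge>0. moment N 0 1 C t = 0 \<and>
       1 / sqrt 2 * moment N 2 1 C t + moment N 0 \<phi> C t = 0 \<and>
       (harmonic \<phi> \<longrightarrow> moment N 1 1 C t = 0 \<and> moment N 1 [:0, 1:] C t = 0))}"

lemma flows_moment_deriv:
  assumes "C \<in> flows N" "t \<ge> 0" "degree f \<le> N" "k \<le> 3"
  shows "(moment N k f C has_real_derivative
    sqrt (real (k + 1)) * moment N (k + 1) (pderiv f) C t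
    - sqrt (real k) * (if k = 0 then 0 else moment N (k - 1) (adj f) C t)
    - (if k \<ge> 3 then 1 else 0) * moment N k f C t) (at t within {0..})"
  by (rule moment_deriv) (use assms in \<open>auto simp: flows_def\<close>)

abbreviation dissipated :: "nat \<Rightarrow> ((nat \<Rightarrow> nat \<Rightarrow> real \<Rightarrow> real) \<Rightarrow> real \<Rightarrow> real) \<Rightarrow> bool" where
  "dissipated N u \<equiv> damped (flows N) (low N) (high N) u"

lemma dissipated_add: "dissipated N u \<Longrightarrow> dissipated N v \<Longrightarrow> dissipated N (\<lambda>C t. u C t + v C t)"
  by (rule damped_add)

lemma dissipated_scale: "dissipated N u \<Longrightarrow> dissipated N (\<lambda>C t. c * u C t)"
  by (rule damped_scale) (auto simp: low_nonneg high_nonneg)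

lemma dissipated_unscale: "c \<noteq> 0 \<Longrightarrow> dissipated N (\<lambda>C t. c * u C t) \<Longrightarrow> dissipated N u"
  using dissipated_scale[of N "\<lambda>C t. c * u C t" "1 / c"] by simp

lemma dissipated_cong: "dissipated N u \<Longrightarrow> (\<And>C t. C \<in> flows N \<Longrightarrow> t \<ge> 0 \<Longrightarrow> v C t = u C t) \<Longrightarrow> dissipated N v"
  by (rule damped_cong)

definition low_moment :: "nat \<Rightarrow> real poly \<Rightarrow> real poly \<Rightarrow> real poly \<Rightarrow> (nat \<Rightarrow> nat \<Rightarrow> real \<Rightarrow> real) \<Rightarrow> real \<Rightarrow> real"
  where "low_moment N f g h C t = moment N 0 f C t + moment N 1 g C t + moment N 2 h C t"

lemma low_moment_bounded: "quad_bounded S (\<lambda>C t. low N C t + high N C t) (low_moment N f g h)"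
  unfolding low_moment_def [abs_def] by (intro quad_bounded_add moment_bounded) auto

lemma low_moment_deriv:
  assumes C: "C \<in> flows N" "t \<ge> 0" and "degree f \<le> N" "degree g \<le> N" "degree h \<le> N"
  shows "(low_moment N f g h C has_real_derivative
     low_moment N (- adj g) (pderiv f - smult (sqrt 2) (adj h)) (smult (sqrt 2) (pderiv g)) C t
     + sqrt 3 * moment N 3 (pderiv h) C t) (at t within {0..})"
proof -
  have d0: "(moment N 0 f C has_real_derivative moment N 1 (pderiv f) C t) (at t within {0..})"
    using flows_moment_deriv[OF C assms(3), of 0] by simp
  have d1: "(moment N 1 g C has_real_derivative
      sqrt 2 * moment N 2 (pderiv g) C t - moment N 0 (adj g) C t) (at t within {0..})"
    using flows_moment_deriv[OF C assms(4), of 1] by (simp add: numeral_2_eq_2)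
  have d2: "(moment N 2 h C has_real_derivative
      sqrt 3 * moment N 3 (pderiv h) C t - sqrt 2 * moment N 1 (adj h) C t) (at t within {0..})"
    using flows_moment_deriv[OF C assms(5), of 2] by simp
  have "(low_moment N f g h C has_real_derivative moment N 1 (pderiv f) C t
      + (sqrt 2 * moment N 2 (pderiv g) C t - moment N 0 (adj g) C t)
      + (sqrt 3 * moment N 3 (pderiv h) C t - sqrt 2 * moment N 1 (adj h) C t)) (at t within {0..})"
    unfolding low_moment_def [abs_def] by (intro DERIV_add d0 d1 d2)
  then show ?thesis by (simp add: low_moment_def moment_linear algebra_simps)
qed

text \<open>
  The time derivative of a moment triple is again a moment triple, up to a moment of level 3, which is
  damped.  The triple on the right may have test polynomials of too high degree; projecting them makes it
  differentiable again by the same formula.\<close>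

lemma dissipated_step:
  assumes "dissipated N (low_moment N f g h)" "degree f \<le> N" "degree g \<le> N" "degree h \<le> N"
  shows "dissipated N (low_moment N (- adj g) (pderiv f - smult (sqrt 2) (adj h)) (smult (sqrt 2) (pderiv g)))"
proof -
  define f1 g1 h1 where "f1 = proj N (- adj g)" and "g1 = proj N (pderiv f - smult (sqrt 2) (adj h))"
    and "h1 = proj N (smult (sqrt 2) (pderiv g))"
  have eq: "low_moment N (- adj g) (pderiv f - smult (sqrt 2) (adj h)) (smult (sqrt 2) (pderiv g)) = low_moment N f1 g1 h1"
    unfolding low_moment_def [abs_def] f1_def g1_def h1_def moment_proj ..
  show ?thesis
  proof (rule damped_derivative[OF assms(1), where r = "\<lambda>C t. sqrt 3 * moment N 3 (pderiv h) C t"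
        and w' = "\<lambda>C t. low_moment N (- adj g1) (pderiv f1 - smult (sqrt 2) (adj h1)) (smult (sqrt 2) (pderiv g1)) C t
          + sqrt 3 * moment N 3 (pderiv h1) C t"])
    fix C t assume C: "C \<in> flows N" "(t :: real) \<ge> 0"
    show "(low_moment N f g h C has_real_derivative
        low_moment N (- adj g) (pderiv f - smult (sqrt 2) (adj h)) (smult (sqrt 2) (pderiv g)) C t
        + sqrt 3 * moment N 3 (pderiv h) C t) (at t within {0..})"
      by (rule low_moment_deriv[OF C assms(2-4)])
    show "(low_moment N (- adj g) (pderiv f - smult (sqrt 2) (adj h)) (smult (sqrt 2) (pderiv g)) C
        has_real_derivative
        low_moment N (- adj g1) (pderiv f1 - smult (sqrt 2) (adj h1)) (smult (sqrt 2) (pderiv g1)) C t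
          + sqrt 3 * moment N 3 (pderiv h1) C t) (at t within {0..})"
      unfolding eq by (rule low_moment_deriv[OF C]) (simp_all add: f1_def g1_def h1_def degree_proj)
  next
    show "quad_bounded (flows N) (\<lambda>C t. low N C t + high N C t)
       (\<lambda>C t. low_moment N (- adj g1) (pderiv f1 - smult (sqrt 2) (adj h1)) (smult (sqrt 2) (pderiv g1)) C t
          + sqrt 3 * moment N 3 (pderiv h1) C t)"
      by (intro quad_bounded_add quad_bounded_scale moment_bounded low_moment_bounded) simp
    show "quad_bounded (flows N) (high N) (\<lambda>C t. sqrt 3 * moment N 3 (pderiv h) C t)"
      by (intro quad_bounded_scale moment_high_bounded) simp
  qed (rule low_nonneg high_nonneg low_moment_bounded)+
qed

text \<open>
  This is where the damping enters: level 3 is damped, and its time derivative contains level 2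
  differentiated in space, that is, tested with an adjoint.\<close>

lemma dissipated_level_2_adj:
  assumes "degree g \<le> N"
  shows "dissipated N (moment N 2 (adj g))"
proof -
  define h where "h = proj N (adj g)"
  have h: "degree h \<le> N" by (simp add: h_def degree_proj)
  have "dissipated N (\<lambda>C t. - sqrt 3 * moment N 2 h C t)"
  proof (rule damped_derivative[where u = "moment N 3 g"
        and r = "\<lambda>C t. 2 * moment N 4 (pderiv g) C t + (- 1) * moment N 3 g C t"
        and w' = "\<lambda>C t. - sqrt 3 * (sqrt 3 * moment N 3 (pderiv h) C t + - sqrt 2 * moment N 1 (adj h) C t)"])
    show "dissipated N (moment N 3 g)"
      by (intro damped_of_quad_bounded moment_high_bounded) (auto simp: low_nonneg high_nonneg)
    fix C t assume C: "C \<in> flows N" "(t :: real) \<ge> 0"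
    show "(moment N 3 g C has_real_derivative - sqrt 3 * moment N 2 h C t
        + (2 * moment N 4 (pderiv g) C t + - 1 * moment N 3 g C t)) (at t within {0..})"
      using flows_moment_deriv[OF C assms, of 3] unfolding h_def moment_proj
      by (simp add: algebra_simps)
    show "((\<lambda>t. - sqrt 3 * moment N 2 h C t) has_real_derivative
        - sqrt 3 * (sqrt 3 * moment N 3 (pderiv h) C t + - sqrt 2 * moment N 1 (adj h) C t)) (at t within {0..})"
      using flows_moment_deriv[OF C h, of 2] by (intro DERIV_cmult) simp
  next
    show "quad_bounded (flows N) (\<lambda>C t. low N C t + high N C t)
       (\<lambda>C t. - sqrt 3 * (sqrt 3 * moment N 3 (pderiv h) C t + - sqrt 2 * moment N 1 (adj h) C t))"
      by (intro quad_bounded_add quad_bounded_scale moment_bounded) auto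
    show "quad_bounded (flows N) (high N) (\<lambda>C t. 2 * moment N 4 (pderiv g) C t + - 1 * moment N 3 g C t)"
      by (intro quad_bounded_add quad_bounded_scale moment_high_bounded) auto
    show "quad_bounded (flows N) (\<lambda>C t. low N C t + high N C t) (\<lambda>C t. - sqrt 3 * moment N 2 h C t)"
      by (intro quad_bounded_scale moment_bounded) auto
  qed (rule low_nonneg high_nonneg moment_bounded | simp)+
  from dissipated_unscale[OF _ this] have "dissipated N (moment N 2 h)" by simp
  then show ?thesis by (simp add: h_def moment_proj)
qed

abbreviation X :: "real poly" where "X \<equiv> [:0, 1:]"

lemma adj_1: "adj 1 = pderiv \<phi>"
  by (simp add: adj_def)

lemma adj_X: "adj X = pderiv \<phi> * X - 1"
  by (simp add: adj_def pderiv_pCons one_pCons)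

lemma degree_\<phi>: "degree \<phi> \<ge> 2"
  using potential by (auto simp: potential_def)

lemma degree_adj_1: "degree (adj 1) \<le> degree \<phi>"
  by (simp add: adj_1 degree_pderiv)

lemma degree_adj_X: "degree (adj X) \<le> degree \<phi>"
proof -
  have "degree (pderiv \<phi> * X) \<le> degree \<phi>"
    using degree_\<phi> degree_mult_le[of "pderiv \<phi>" X] by (simp add: degree_pderiv)
  then show ?thesis unfolding adj_X by (intro degree_diff_le) auto
qed

lemma E_X: "E X = 0"
  by (rule E_odd) simp

lemma E_pderiv2: "E (pderiv (pderiv \<phi>)) = 1"
  using potential by (simp add: potential_def mean_def avg_def)

lemma E_const: "E [:c:] = c"
  using E_smult[of c 1] E_1 by simp

lemma E_X2_pos: "E (X * X) > 0"
  by (rule E_square_pos) simp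

text \<open>
  All of level 2 except its mean is controlled by its spatial derivative.\<close>

lemma dissipated_level_2_centred:
  assumes "E f = 0"
  shows "dissipated N (moment N 2 f)"
proof -
  obtain g where g: "degree g \<le> N" "\<And>h. degree h \<le> N \<Longrightarrow> E (adj g * h) = E (f * h)"
    using adj_surj[OF assms] by metis
  have "moment N 2 f = moment N 2 (adj g)" by (rule moment_cong) (simp add: g(2))
  then show ?thesis using dissipated_level_2_adj[OF g(1)] by simp
qed

text \<open>
  The derivative of a centred level-2 moment controls level 1 up to affine functions; the mean of \<open>f\<close> is the
  product of \<open>g\<close> with the function \<open>x\<close>.\<close>

lemma dissipated_level_1_orthogonal:
  assumes "N \<ge> 1" "E g = 0" "E (g * X) = 0"
  shows "dissipated N (moment N 1 g)"
proof -
  obtain f where f: "degree f \<le> N" "\<And>h. degree h \<le> N \<Longrightarrow> E (adj f * h) = E (g * h)"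
    using adj_surj[OF assms(2)] by metis
  have "E f = E (f * pderiv X)" by (simp add: pderiv_pCons)
  also have "\<dots> = E (g * X)"
    using f(2)[of X] assms(1) unfolding E_adj by simp
  finally have "dissipated N (low_moment N 0 0 f)"
    using dissipated_level_2_centred[of f N] assms(3) by (simp add: low_moment_def [abs_def] moment_0)
  from dissipated_step[OF this] f(1)
  have "dissipated N (low_moment N (- adj 0) (pderiv 0 - smult (sqrt 2) (adj f)) (smult (sqrt 2) (pderiv 0)))"
    by simp
  then have "dissipated N (\<lambda>C t. - sqrt 2 * moment N 1 (adj f) C t)"
    by (rule dissipated_cong) (simp add: low_moment_def moment_linear adj_def)
  from dissipated_unscale[OF _ this] have "dissipated N (moment N 1 (adj f))" by simp
  moreover have "moment N 1 g = moment N 1 (adj f)" by (rule moment_cong) (simp add: f(2))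
  ultimately show ?thesis by simp
qed

text \<open>
  In the derivative of a level-1 moment the part of level 2 survives only through its mean, because its
  centred part has already been dealt with.\<close>

lemma dissipated_level_0_adj:
  assumes "dissipated N (moment N 1 g)" "degree g \<le> N"
  shows "dissipated N (low_moment N (adj g) 0 [:- sqrt 2 * E (pderiv g):])"
proof -
  define m where "m = E (pderiv g)"
  have "dissipated N (low_moment N 0 g 0)"
    using assms(1) by (simp add: low_moment_def [abs_def] moment_0)
  from dissipated_step[OF this] assms(2)
  have step: "dissipated N (low_moment N (- adj g) (pderiv 0 - smult (sqrt 2) (adj 0)) (smult (sqrt 2) (pderiv g)))"
    by simp
  have "dissipated N (moment N 2 (pderiv g - [:m:]))"
    by (rule dissipated_level_2_centred) (simp add: E_linear E_const m_def)
  from dissipated_add[OF dissipated_scale[OF step, of "- 1"] dissipated_scale[OF this, of "sqrt 2"]]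
  show ?thesis
  proof (rule dissipated_cong)
    fix C t
    have "moment N 2 [:- sqrt 2 * m:] C t = - sqrt 2 * moment N 2 [:m:] C t"
      using moment_smult[of N 2 "- sqrt 2" "[:m:]" C t] by simp
    then show "low_moment N (adj g) 0 [:- sqrt 2 * E (pderiv g):] C t =
       - 1 * low_moment N (- adj g) (pderiv 0 - smult (sqrt 2) (adj 0)) (smult (sqrt 2) (pderiv g)) C t
       + sqrt 2 * moment N 2 (pderiv g - [:m:]) C t"
      unfolding m_def [symmetric]
      by (simp add: low_moment_def moment_linear adj_def algebra_simps)
  qed
qed

text \<open>
  One further derivative returns to level 1, with the test polynomial \<open>q\<close>.  Modulo what is known it may be
  replaced by its affine part, which integration by parts expresses through \<open>g\<close> and the derivatives of \<open>\<phi>\<close>.  The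
  truncation is harmless because \<open>adj 1\<close> and \<open>adj X\<close> have degree at most that of \<open>\<phi>\<close>, hence at most \<open>N\<close>.\<close>

lemma dissipated_level_1_affine:
  assumes "N \<ge> degree \<phi>" "degree g \<le> N" "E g = 0" "E (g * X) = 0"
  shows "dissipated N (\<lambda>C t. E (g * pderiv (pderiv \<phi>)) * moment N 1 1 C t +
    E (g * (3 * pderiv \<phi> + X * pderiv (pderiv \<phi>))) / E (X * X) * moment N 1 X C t)"
proof -
  have N: "N \<ge> 2" using assms(1) degree_\<phi> by simp
  define m h q where "m = E (pderiv g)" and "h = proj N (adj g)"
    and "q = pderiv h + smult (2 * m) (pderiv \<phi>)"
  have m: "m = E (g * pderiv \<phi>)"
    unfolding m_def integration_by_parts by (simp add: mult.commute)
  have "dissipated N (moment N 1 g)" by (rule dissipated_level_1_orthogonal) (use N assms in auto)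
  from dissipated_level_0_adj[OF this assms(2)]
  have "dissipated N (low_moment N h 0 [:- sqrt 2 * m:])"
    by (simp add: low_moment_def [abs_def] h_def moment_proj m_def)
  from dissipated_step[OF this] N
  have "dissipated N (low_moment N (- adj 0) (pderiv h - smult (sqrt 2) (adj [:- sqrt 2 * m:])) (smult (sqrt 2) (pderiv 0)))"
    by (simp add: h_def degree_proj)
  moreover have "smult (sqrt 2) (adj [:- sqrt 2 * m:]) = smult (- 2 * m) (pderiv \<phi>)"
    by (simp add: adj_def pderiv_pCons flip: mult.assoc)
  ultimately have q1: "dissipated N (moment N 1 q)"
    by (simp add: low_moment_def [abs_def] moment_0 adj_def q_def)
  have hE: "E (h * p) = E (adj g * p)" if "degree p \<le> degree \<phi>" for p
    unfolding h_def using that assms(1) by (intro E_proj) simp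
  have Eq: "E q = E (g * pderiv (pderiv \<phi>))"
  proof -
    have "E (pderiv \<phi>) = 0" using integration_by_parts[of 1] by (simp add: E_0)
    then have "E q = E (adj 1 * h)" by (simp add: q_def E_linear E_adj)
    also have "\<dots> = E (adj g * adj 1)"
      using hE[OF degree_adj_1] by (simp only: mult.commute)
    finally show ?thesis by (simp add: E_adj adj_1)
  qed
  have EqX: "E (q * X) = E (g * (3 * pderiv \<phi> + X * pderiv (pderiv \<phi>)))"
  proof -
    have "E (pderiv \<phi> * X) = 1"
      using integration_by_parts[of X] by (simp add: pderiv_pCons E_const)
    then have "E (q * X) = E (X * pderiv h) + 2 * m"
      by (simp only: q_def distrib_right E_linear mult_smult_left mult.commute[of "pderiv h"])
    also have "E (X * pderiv h) = E (adj X * h)" by (rule E_adj[symmetric])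
    also have "\<dots> = E (adj g * adj X)"
      using hE[OF degree_adj_X] by (simp only: mult.commute)
    also have "\<dots> = E (g * (X * pderiv (pderiv \<phi>) + pderiv \<phi>))"
      unfolding E_adj adj_X by (simp add: pderiv_diff pderiv_mult pderiv_pCons algebra_simps)
    finally have "E (q * X) = E (g * (X * pderiv (pderiv \<phi>) + pderiv \<phi>)) + 2 * E (g * pderiv \<phi>)"
      unfolding m .
    also have "\<dots> = E (g * (X * pderiv (pderiv \<phi>) + pderiv \<phi>) + smult 2 (g * pderiv \<phi>))"
      by (simp only: E_linear)
    also have "smult 2 (g * pderiv \<phi>) = g * pderiv \<phi> + g * pderiv \<phi>"
      using smult_add_left[of 1 1 "g * pderiv \<phi>"] by simp
    also have "g * (X * pderiv (pderiv \<phi>) + pderiv \<phi>) + (g * pderiv \<phi> + g * pderiv \<phi>)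
        = g * (3 * pderiv \<phi> + X * pderiv (pderiv \<phi>))"
      by algebra
    finally show ?thesis .
  qed
  define b where "b = E (q * X) / E (X * X)"
  have "dissipated N (moment N 1 (q - [:E q:] - smult b X))"
  proof (rule dissipated_level_1_orthogonal)
    show "E (q - [:E q:] - smult b X) = 0" by (simp only: E_linear E_const E_X)
    have "[:E q:] * X = smult (E q) X" by simp
    then have "E ((q - [:E q:] - smult b X) * X) = E (q * X) - E (smult (E q) X) - b * E (X * X)"
      by (simp only: left_diff_distrib mult_smult_left E_diff E_smult[of b])
    then show "E ((q - [:E q:] - smult b X) * X) = 0"
      using E_X2_pos by (simp only: E_smult E_X b_def) simp
  qed (use N in simp)
  from dissipated_add[OF q1 dissipated_scale[OF this, of "- 1"]]
  have "dissipated N (\<lambda>C t. E q * moment N 1 1 C t + b * moment N 1 X C t)"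
  proof (rule dissipated_cong)
    fix C t
    have "moment N 1 [:E q:] C t = E q * moment N 1 1 C t"
      using moment_smult[of N 1 "E q" 1 C t] by simp
    moreover have "moment N 1 (smult b X) C t = b * moment N 1 X C t"
      by (rule moment_smult)
    ultimately show "E q * moment N 1 1 C t + b * moment N 1 X C t =
        moment N 1 q C t + - 1 * moment N 1 (q - [:E q:] - smult b X) C t"
      by (simp only: moment_diff) (simp add: algebra_simps)
  qed
  then show ?thesis unfolding b_def Eq EqX .
qed

end

text \<open>
  The two normalizations fix the leading and the constant coefficient, the evenness excludes a linear term.\<close>

lemma harmonic_of_quadratic:
  assumes "potential \<phi>" "degree \<phi> = 2"
  shows "harmonic \<phi>"
proof -
  have even: "poly \<phi> (- x) = poly \<phi> x" and mass: "(LINT x|lborel. rho \<phi> x) = 1"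
    and curv: "(LINT x|lborel. poly (pderiv (pderiv \<phi>)) x * rho \<phi> x) = 1" for x
    using assms(1) by (auto simp: potential_def)
  define a b c where "a = coeff \<phi> 2" and "b = coeff \<phi> 1" and "c = coeff \<phi> 0"
  have \<phi>: "\<phi> = [:c, b, a:]"
  proof (rule poly_eqI)
    fix k
    show "coeff \<phi> k = coeff [:c, b, a:] k"
      using assms(2) unfolding a_def b_def c_def
      by (cases "k > 2") (auto simp: coeff_eq_0 not_less numeral_2_eq_2 le_Suc_eq coeff_pCons split: nat.splits)
  qed
  have "b = 0" using even[of 1] by (simp add: \<phi>)
  have "2 * a = 1"
    using curv mass by (simp add: \<phi> pderiv_pCons)
  then have val: "poly \<phi> x = c + x\<^sup>2 / 2" for x
    using \<open>b = 0\<close> by (simp add: \<phi> power2_eq_square field_simps)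
  have "rho \<phi> x = (exp (- c) * sqrt (2 * pi)) * std_normal_density x" for x
  proof -
    have "rho \<phi> x = exp (- c) * exp (- x\<^sup>2 / 2)"
      by (simp add: rho_def val flip: exp_add)
    then show ?thesis by (simp add: std_normal_density_def)
  qed
  then have "(LINT x|lborel. rho \<phi> x) = exp (- c) * sqrt (2 * pi)"
    using integral_normal_density[of 1 0] by simp
  then have "exp c = sqrt (2 * pi)"
    using mass by (simp add: exp_minus field_simps)
  then have "c = ln (2 * pi) / 2"
    using ln_exp[of c] ln_sqrt[of "2 * pi"] by simp
  then show ?thesis
    by (simp add: harmonic_def val field_simps)
qed

context orthonormal_potential begin

lemma \<phi>_even: "poly \<phi> (- x) = poly \<phi> x"
  using potential by (simp add: potential_def)

lemma poly_pderiv_even: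
  fixes p :: "real poly"
  assumes "\<And>x. poly p (- x) = poly p x"
  shows "poly (pderiv p) (- x) = - poly (pderiv p) x"
proof -
  have "pcompose p [:0, -1:] = p"
    using assms by (simp add: poly_eq_poly_eq_iff[symmetric] fun_eq_iff poly_pcompose)
  then have "pderiv p = pcompose (pderiv p) [:0, -1:] * pderiv [:0, -1:]"
    using pderiv_pcompose[of p "[:0, -1:]"] by simp
  then have "poly (pderiv p) x = poly (pcompose (pderiv p) [:0, -1:] * pderiv [:0, -1:]) x"
    by (rule arg_cong)
  then show ?thesis by (simp add: poly_pcompose pderiv_pCons)
qed

lemma poly_pderiv_odd:
  fixes p :: "real poly"
  assumes "\<And>x. poly p (- x) = - poly p x"
  shows "poly (pderiv p) (- x) = poly (pderiv p) x"
proof -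
  have "pcompose p [:0, -1:] = - p"
    using assms by (simp add: poly_eq_poly_eq_iff[symmetric] fun_eq_iff poly_pcompose)
  then have "pderiv (- p) = pcompose (pderiv p) [:0, -1:] * pderiv [:0, -1:]"
    using pderiv_pcompose[of p "[:0, -1:]"] by simp
  then have "poly (pderiv (- p)) x = poly (pcompose (pderiv p) [:0, -1:] * pderiv [:0, -1:]) x"
    by (rule arg_cong)
  then show ?thesis by (simp add: poly_pcompose pderiv_pCons pderiv_minus)
qed

lemmas \<phi>_parity = \<phi>_even poly_pderiv_even[OF \<phi>_even] poly_pderiv_odd[OF poly_pderiv_even[OF \<phi>_even]]

text \<open>
  In the harmonic case both moments are invariants with value 0.  Otherwise the degree is at least 4, and
  the two functions \<open>\<phi>''\<close> and \<open>3 \<phi>' + x \<phi>''\<close>, the first even and the second odd, are not affine.  Testing with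
  their parts orthogonal to the affine functions isolates the mean and the first moment, respectively.\<close>

lemma dissipated_level_1_basis:
  assumes N: "N \<ge> degree \<phi>"
  shows "dissipated N (moment N 1 1)" "dissipated N (moment N 1 X)"
proof -
  have "dissipated N (moment N 1 1) \<and> dissipated N (moment N 1 X)"
  proof (cases "harmonic \<phi>")
    case True
    have zero: "dissipated N (\<lambda>C t. 0)"
      by (intro damped_of_quad_bounded) (auto simp: quad_bounded_def low_nonneg high_nonneg)
    show ?thesis
      by (intro conjI; rule dissipated_cong[OF zero]) (use True in \<open>auto simp: flows_def\<close>)
  next
    case False
    define d where "d = degree \<phi>"
    have d: "d \<ge> 4" "coeff \<phi> d \<noteq> 0"
    proof -
      obtain m where m: "m \<ge> 1" "degree \<phi> = 2 * m"
        using potential by (auto simp: potential_def)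
      moreover have "m \<noteq> 1" using harmonic_of_quadratic[OF potential] False m by auto
      ultimately show "d \<ge> 4" by (simp add: d_def)
      show "coeff \<phi> d \<noteq> 0" using potential by (auto simp: potential_def d_def)
    qed
    define \<psi> where "\<psi> = 3 * pderiv \<phi> + X * pderiv (pderiv \<phi>)"
    have \<psi>: "\<psi> = smult 3 (pderiv \<phi>) + pCons 0 (pderiv (pderiv \<phi>))"
      by (simp add: \<psi>_def numeral_poly)
    \<comment> \<open>This coefficient is \<open>d (d + 2)\<close> times the leading coefficient of \<open>\<phi>\<close>, and \<open>d - 1 > 1\<close>.\<close>
    have c\<psi>: "coeff \<psi> (d - 1) \<noteq> 0"
    proof -
      obtain e where e: "d = Suc (Suc e)" using d(1) that[of "d - 2"] by simp
      have "coeff \<psi> (d - 1) = (3 * real d + real d * (real d - 1)) * coeff \<phi> d"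
        unfolding \<psi> by (simp add: e coeff_pderiv algebra_simps)
      moreover have "3 * real d + real d * (real d - 1) > 0" using d by (simp add: add_pos_pos)
      ultimately show ?thesis using d(2) by simp
    qed
    have deg\<psi>: "degree \<psi> \<le> N"
    proof -
      have "degree (smult 3 (pderiv \<phi>)) \<le> N" using N by (simp add: degree_pderiv)
      moreover have "degree (pCons 0 (pderiv (pderiv \<phi>))) \<le> N"
        using N degree_\<phi> by (intro order.trans[OF degree_pCons_le]) (simp add: degree_pderiv)
      ultimately show ?thesis unfolding \<psi> by (intro degree_add_le)
    qed
    have \<psi>_odd: "poly \<psi> (- x) = - poly \<psi> x" for x
      by (simp add: \<psi> \<phi>_parity algebra_simps)
    have step: "dissipated N (\<lambda>C t. E (g * pderiv (pderiv \<phi>)) * moment N 1 1 C t +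
        E (g * \<psi>) / E (X * X) * moment N 1 X C t)"
      if "degree g \<le> N" "E g = 0" "E (g * X) = 0" for g
      using dissipated_level_1_affine[OF N that] unfolding \<psi>_def .
    have one: "dissipated N (moment N 1 1)"
    proof -
      define g where "g = pderiv (pderiv \<phi>) - 1"
      have Eg: "E g = 0" by (simp add: g_def E_linear E_1 E_pderiv2)
      have "dissipated N (\<lambda>C t. E (g * pderiv (pderiv \<phi>)) * moment N 1 1 C t +
        E (g * \<psi>) / E (X * X) * moment N 1 X C t)"
      proof (rule step[OF _ Eg])
        show "degree g \<le> N" unfolding g_def
          using N by (intro degree_diff_le) (auto simp: degree_pderiv)
        show "E (g * X) = 0" by (rule E_odd) (simp add: g_def \<phi>_parity)
      qed
      moreover have "E (g * \<psi>) = 0"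
        by (rule E_odd) (simp add: g_def \<phi>_parity \<psi>_odd)
      moreover have "E (g * pderiv (pderiv \<phi>)) = E (g * g)"
      proof -
        have "g * pderiv (pderiv \<phi>) = g * g + g" by (simp add: g_def algebra_simps)
        then show ?thesis by (simp add: E_linear Eg)
      qed
      moreover have "E (g * g) \<noteq> 0"
      proof -
        obtain e where e: "d = Suc (Suc (Suc e))" using d(1) that[of "d - 3"] by simp
        have "coeff g (d - 2) \<noteq> 0"
          using d(2) by (simp add: g_def e coeff_pderiv)
        then have "g \<noteq> 0" by auto
        then show ?thesis using E_square_pos by force
      qed
      ultimately show ?thesis using dissipated_unscale[of "E (g * g)" N "moment N 1 1"] by simp
    qed
    have "dissipated N (moment N 1 X)"
    proof -
      define c where "c = E (\<psi> * X) / E (X * X)"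
      define g where "g = \<psi> - smult c X"
      have gX: "E (g * X) = 0"
        using E_X2_pos by (simp only: g_def left_diff_distrib mult_smult_left E_linear c_def) simp
      have "dissipated N (\<lambda>C t. E (g * pderiv (pderiv \<phi>)) * moment N 1 1 C t +
        E (g * \<psi>) / E (X * X) * moment N 1 X C t)"
      proof (rule step[OF _ _ gX])
        have "degree (smult c X) \<le> N" using degree_smult_le[of c X] N degree_\<phi> by simp
        then show "degree g \<le> N" unfolding g_def using deg\<psi> by (intro degree_diff_le)
        show "E g = 0" by (rule E_odd) (simp add: g_def \<psi>_odd)
      qed
      from dissipated_add[OF this dissipated_scale[OF one, of "- E (g * pderiv (pderiv \<phi>))"]]
      have "dissipated N (\<lambda>C t. E (g * \<psi>) / E (X * X) * moment N 1 X C t)"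
        by (rule dissipated_cong) simp
      moreover have "E (g * \<psi>) = E (g * g)"
      proof -
        have "g * \<psi> = g * g + smult c (g * X)"
          by (simp only: g_def mult_smult_right[symmetric] distrib_left[symmetric]) simp
        then show ?thesis by (simp only: E_linear gX)
      qed
      moreover have "E (g * g) \<noteq> 0"
      proof -
        obtain e where e: "d = Suc (Suc (Suc e))" using d(1) that[of "d - 3"] by simp
        have "coeff (smult c X) (d - 1) = 0" by (simp add: e)
        then have "coeff g (d - 1) \<noteq> 0" using c\<psi> by (simp add: g_def)
        then have "g \<noteq> 0" by auto
        then show ?thesis using E_square_pos by force
      qed
      ultimately show ?thesis
        using E_X2_pos dissipated_unscale[of "E (g * g) / E (X * X)" N "moment N 1 X"] by simp
    qed
    with one show ?thesis ..
  qed
  then show "dissipated N (moment N 1 1)" "dissipated N (moment N 1 X)" by auto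
qed

lemma dissipated_level_1:
  assumes N: "N \<ge> degree \<phi>"
  shows "dissipated N (moment N 1 f)"
proof -
  define b where "b = E (f * X) / E (X * X)"
  define g where "g = f - [:E f:] - smult b X"
  have f: "f = g + (smult (E f) 1 + smult b X)" by (simp add: g_def)
  have "dissipated N (moment N 1 g)"
  proof (rule dissipated_level_1_orthogonal)
    show "N \<ge> 1" using N degree_\<phi> by simp
    show "E g = 0" by (simp only: g_def E_linear E_const E_X)
    have "[:E f:] * X = smult (E f) X" by simp
    then have "E (g * X) = E (f * X) - E (smult (E f) X) - b * E (X * X)"
      by (simp only: g_def left_diff_distrib mult_smult_left E_diff E_smult[of b])
    then show "E (g * X) = 0"
      using E_X2_pos by (simp only: E_smult E_X b_def) simp
  qed
  from dissipated_add[OF this dissipated_add[OF dissipated_scale[OF dissipated_level_1_basis(1)[OF N], of "E f"]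
        dissipated_scale[OF dissipated_level_1_basis(2)[OF N], of b]]]
  show ?thesis by (rule dissipated_cong) (subst f, simp only: moment_linear)
qed

text \<open>
  Level 0 follows from the now fully controlled level 1, with the same remaining mean of level 2; the
  product of \<open>q\<close> and \<open>\<phi>\<close> appears since \<open>\<phi>\<close> itself is resolved by the truncation.\<close>

lemma dissipated_level_0_centred:
  assumes N: "N \<ge> degree \<phi>" and "E q = 0"
  shows "dissipated N (\<lambda>C t. moment N 0 q C t - sqrt 2 * E (q * \<phi>) * moment N 2 1 C t)"
proof -
  obtain f where f: "degree f \<le> N" "\<And>h. degree h \<le> N \<Longrightarrow> E (adj f * h) = E (q * h)"
    using adj_surj[OF assms(2)] by metis
  have "E (pderiv f) = E (f * pderiv \<phi>)"
    unfolding integration_by_parts by (simp add: mult.commute)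
  also have "\<dots> = E (q * \<phi>)"
    using f(2)[OF N] by (simp add: E_adj)
  finally have 1: "E (pderiv f) = E (q * \<phi>)" .
  have 2: "moment N 0 (adj f) = moment N 0 q" by (rule moment_cong) (rule f(2))
  show ?thesis
  proof (rule dissipated_cong[OF dissipated_level_0_adj[OF dissipated_level_1[OF N] f(1)]])
    fix C t
    have "moment N 2 [:- sqrt 2 * E (pderiv f):] C t = - sqrt 2 * E (q * \<phi>) * moment N 2 1 C t"
      using moment_smult[of N 2 "- sqrt 2 * E (pderiv f)" 1 C t] by (simp add: 1)
    then show "moment N 0 q C t - sqrt 2 * E (q * \<phi>) * moment N 2 1 C t =
        low_moment N (adj f) 0 [:- sqrt 2 * E (pderiv f):] C t"
      by (simp add: low_moment_def 2 moment_0)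
  qed
qed

text \<open>
  The mean of level 2 is the last unknown.  The energy invariant ties it to the level-0 moment of \<open>\<phi>\<close>, and
  taking \<open>q = \<phi> - \<langle>\<phi>\<rangle>\<close> in the previous lemma gives a second, independent relation, because the
  variance of \<open>\<phi>\<close> is positive.\<close>

lemma dissipated_level_2:
  assumes N: "N \<ge> degree \<phi>"
  shows "dissipated N (moment N 2 f)"
proof -
  define q where "q = \<phi> - [:E \<phi>:]"
  have Eq: "E q = 0" by (simp add: q_def E_linear E_const)
  have "q * \<phi> = q * (q + [:E \<phi>:])" by (simp add: q_def)
  then have "q * \<phi> = q * q + smult (E \<phi>) q" by (simp only: distrib_left) simp
  then have var: "E (q * \<phi>) = E (q * q)" by (simp add: E_linear Eq)
  have "q \<noteq> 0"
  proof
    assume "q = 0"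
    then have "\<phi> = [:E \<phi>:]" by (simp add: q_def)
    then have "degree \<phi> = 0" by (metis degree_pCons_0)
    then show False using degree_\<phi> by simp
  qed
  then have pos: "1 / sqrt 2 + sqrt 2 * E (q * q) > 0"
    using E_square_pos[of q] by (intro add_pos_pos) auto
  have "dissipated N (\<lambda>C t. - (1 / sqrt 2 + sqrt 2 * E (q * q)) * moment N 2 1 C t)"
  proof (rule dissipated_cong[OF dissipated_level_0_centred[OF N Eq]])
    fix C t assume "C \<in> flows N" "(t :: real) \<ge> 0"
    then have inv: "moment N 0 1 C t = 0" "1 / sqrt 2 * moment N 2 1 C t + moment N 0 \<phi> C t = 0"
      by (auto simp: flows_def)
    have "moment N 0 q C t = moment N 0 \<phi> C t"
      using moment_smult[of N 0 "E \<phi>" 1 C t] inv(1) by (simp add: q_def moment_linear)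
    then show "- (1 / sqrt 2 + sqrt 2 * E (q * q)) * moment N 2 1 C t =
        moment N 0 q C t - sqrt 2 * E (q * \<phi>) * moment N 2 1 C t"
      using inv(2) unfolding var by (simp add: algebra_simps)
  qed
  then have one: "dissipated N (moment N 2 1)"
    using pos by (intro dissipated_unscale[of "- (1 / sqrt 2 + sqrt 2 * E (q * q))" N "moment N 2 1"]) auto
  have "dissipated N (moment N 2 (f - [:E f:]))"
    by (rule dissipated_level_2_centred) (simp add: E_linear E_const)
  from dissipated_add[OF this dissipated_scale[OF one, of "E f"]]
  show ?thesis
  proof (rule dissipated_cong)
    fix C t
    show "moment N 2 f C t = moment N 2 (f - [:E f:]) C t + E f * moment N 2 1 C t"
      using moment_smult[of N 2 "E f" 1 C t] by (simp add: moment_diff)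
  qed
qed

lemma dissipated_level_0:
  assumes N: "N \<ge> degree \<phi>"
  shows "dissipated N (moment N 0 f)"
proof -
  define q where "q = f - [:E f:]"
  have "E q = 0" by (simp add: q_def E_linear E_const)
  from dissipated_add[OF dissipated_level_0_centred[OF N this]
      dissipated_scale[OF dissipated_level_2[OF N, of 1], of "sqrt 2 * E (q * \<phi>)"]]
  show ?thesis
  proof (rule dissipated_cong)
    fix C t assume "C \<in> flows N" "(t :: real) \<ge> 0"
    then have "moment N 0 1 C t = 0" by (auto simp: flows_def)
    then have "moment N 0 [:E f:] C t = 0"
      using moment_smult[of N 0 "E f" 1 C t] by simp
    then show "moment N 0 f C t = moment N 0 q C t - sqrt 2 * E (q * \<phi>) * moment N 2 1 C t
        + sqrt 2 * E (q * \<phi>) * moment N 2 1 C t"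
      by (simp add: q_def moment_diff)
  qed
qed

lemma low_dissipates:
  assumes N: "N \<ge> degree \<phi>" and "\<epsilon> > 0"
  shows "\<exists>B F F'. dissipates (flows N) (low N) (high N) (low N) \<epsilon> B F F'"
proof -
  define I where "I = {..2 :: nat} \<times> {..N}"
  have dis: "dissipated N (moment N (fst i) (P (snd i)))" if "i \<in> I" for i
  proof -
    have "fst i = 0 \<or> fst i = 1 \<or> fst i = 2" using that by (auto simp: I_def)
    then show ?thesis using dissipated_level_0[OF N] dissipated_level_1[OF N] dissipated_level_2[OF N] by metis
  qed
  have low: "(\<Sum>i\<in>I. (moment N (fst i) (P (snd i)) C t)\<^sup>2) = low N C t" for C t
  proof -
    have "(\<Sum>i\<in>I. (moment N (fst i) (P (snd i)) C t)\<^sup>2) = (\<Sum>k\<le>2. \<Sum>n\<le>N. (moment N k (P n) C t)\<^sup>2)"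
      unfolding I_def by (simp add: sum.cartesian_product case_prod_beta)
    also have "\<dots> = (\<Sum>k\<le>2. level N k C t)"
      unfolding level_def by (intro sum.cong refl) (simp add: moment_P)
    also have "\<dots> = low N C t" by (simp add: low_def numeral_2_eq_2)
    finally show ?thesis .
  qed
  have "finite I" by (simp add: I_def)
  from dissipates_sum[where u = "\<lambda>i. moment N (fst i) (P (snd i))", OF this dis assms(2)
      low_nonneg high_nonneg]
  show ?thesis unfolding low by blast
qed

end

section \<open>Invariants and the energy balance\<close>

lemma zero_derivative_constant:
  fixes f :: "real \<Rightarrow> real"
  assumes "\<And>t. t \<ge> 0 \<Longrightarrow> (f has_real_derivative 0) (at t within {0..})" "t \<ge> 0"
  shows "f t = f 0"
proof -
  have "\<exists>c. \<forall>x\<in>{0..}. f x = c"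
    by (rule has_field_derivative_zero_constant) (use assms(1) in auto)
  then show ?thesis using assms(2) by force
qed

text \<open>
  The sum of the two squares is conserved.\<close>

lemma rotation_zero:
  fixes u w :: "real \<Rightarrow> real"
  assumes "\<And>t. t \<ge> 0 \<Longrightarrow> (u has_real_derivative c * w t) (at t within {0..})"
    and "\<And>t. t \<ge> 0 \<Longrightarrow> (w has_real_derivative - (c * u t)) (at t within {0..})"
    and "u 0 = 0" "w 0 = 0" "t \<ge> 0"
  shows "u t = 0 \<and> w t = 0"
proof -
  have "((\<lambda>t. u t * u t + w t * w t) has_real_derivative 0) (at t within {0..})" if "t \<ge> 0" for t
    using DERIV_add[OF DERIV_mult[OF assms(1)[OF that] assms(1)[OF that]]
        DERIV_mult[OF assms(2)[OF that] assms(2)[OF that]]]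
    by (simp add: algebra_simps)
  from zero_derivative_constant[OF this assms(5)] have "u t * u t + w t * w t = 0"
    using assms(3,4) by simp
  then show ?thesis by (simp add: sum_squares_eq_zero_iff)
qed

context orthonormal_potential begin

text \<open>
  Mass and energy are conserved.  In the harmonic case the moments \<open>\<langle>x r\<rangle>\<close> and \<open>\<langle>m\<rangle>\<close> rotate into each other
  with frequency 1, as do \<open>\<langle>x m\<rangle>\<close> and the difference of the two energies with frequency 2, so all of them
  remain 0.\<close>

lemma flowsI:
  assumes ode: "\<And>k n t. k \<le> 3 \<Longrightarrow> n \<le> N \<Longrightarrow> t \<ge> 0 \<Longrightarrow>
      (C k n has_real_derivative flow_rhs N k n C t) (at t within {0..})"
    and N: "N \<ge> degree \<phi>"
    and mass: "moment N 0 1 C 0 = 0"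
    and energy: "1 / sqrt 2 * moment N 2 1 C 0 + moment N 0 \<phi> C 0 = 0"
    and harm: "harmonic \<phi> \<Longrightarrow> moment N 0 X C 0 = 0 \<and> moment N 1 1 C 0 = 0 \<and> moment N 1 X C 0 = 0 \<and>
      1 / sqrt 2 * moment N 2 1 C 0 - moment N 0 \<phi> C 0 = 0"
  shows "C \<in> flows N"
proof -
  have N2: "N \<ge> 2" using N degree_\<phi> by simp
  have d0: "(moment N 0 f C has_real_derivative moment N 1 (pderiv f) C t) (at t within {0..})"
    if "t \<ge> 0" "degree f \<le> N" for f t
    using moment_deriv[of N C 0 t f, OF ode] that by simp
  have d1: "(moment N 1 f C has_real_derivative
      sqrt 2 * moment N 2 (pderiv f) C t - moment N 0 (adj f) C t) (at t within {0..})"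
    if "t \<ge> 0" "degree f \<le> N" for f t
    using moment_deriv[of N C 1 t f, OF ode] that by (simp add: numeral_2_eq_2)
  have d2: "(moment N 2 1 C has_real_derivative - sqrt 2 * moment N 1 (pderiv \<phi>) C t) (at t within {0..})"
    if "t \<ge> 0" for t
    using moment_deriv[of N C 2 t 1, OF ode] that by (simp add: moment_0 adj_1)
  have mass_t: "moment N 0 1 C t = 0" if "t \<ge> 0" for t
  proof -
    have "(moment N 0 1 C has_real_derivative 0) (at t within {0..})" if "t \<ge> 0" for t
      using d0[OF that, of 1] by (simp add: moment_0)
    from zero_derivative_constant[OF this that] mass show ?thesis by simp
  qed
  have energy_deriv: "((\<lambda>t. 1 / sqrt 2 * moment N 2 1 C t + s * moment N 0 \<phi> C t) has_real_derivative
      (s - 1) * moment N 1 (pderiv \<phi>) C t) (at t within {0..})" if "t \<ge> 0" for s t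
    using DERIV_add[OF DERIV_cmult[OF d2[OF that], of "1 / sqrt 2"] DERIV_cmult[OF d0[OF that N], of s]]
    by (simp add: algebra_simps)
  have energy_t: "1 / sqrt 2 * moment N 2 1 C t + moment N 0 \<phi> C t = 0" if "t \<ge> 0" for t
  proof -
    have "((\<lambda>t. 1 / sqrt 2 * moment N 2 1 C t + 1 * moment N 0 \<phi> C t) has_real_derivative 0)
        (at t within {0..})" if "t \<ge> 0" for t
      using energy_deriv[OF that, of 1] by simp
    from zero_derivative_constant[OF this that] energy show ?thesis by simp
  qed
  have "moment N 1 1 C t = 0 \<and> moment N 1 X C t = 0" if h: "harmonic \<phi>" and t: "t \<ge> 0" for t
  proof
    have \<phi>: "\<phi> = smult (1 / 2) (X * X) + smult (ln (2 * pi) / 2) 1"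
      using h by (simp add: harmonic_def poly_eq_poly_eq_iff[symmetric] fun_eq_iff power2_eq_square field_simps)
    have d\<phi>: "pderiv \<phi> = X"
      by (subst \<phi>) (simp add: pderiv_add pderiv_smult pderiv_pCons)
    have X2: "moment N 0 (X * X) C t = 2 * moment N 0 \<phi> C t" if "t \<ge> 0" for t
    proof -
      have "moment N 0 \<phi> C t = 1 / 2 * moment N 0 (X * X) C t + ln (2 * pi) / 2 * moment N 0 1 C t"
        using arg_cong[OF \<phi>, of "\<lambda>p. moment N 0 p C t"] by (simp only: moment_add moment_smult)
      then show ?thesis using mass_t[OF that] by simp
    qed
    have "moment N 0 X C t = 0 \<and> moment N 1 1 C t = 0"
    proof (rule rotation_zero[where c = 1 and u = "moment N 0 X C" and w = "moment N 1 1 C" and t = t])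
      fix t :: real assume t: "t \<ge> 0"
      show "(moment N 0 X C has_real_derivative 1 * moment N 1 1 C t) (at t within {0..})"
        using d0[OF t, of X] N2 by (simp add: pderiv_pCons one_pCons)
      show "(moment N 1 1 C has_real_derivative - (1 * moment N 0 X C t)) (at t within {0..})"
        using d1[OF t, of 1] by (simp add: moment_0 adj_1 d\<phi>)
    qed (use harm[OF h] t in auto)
    then show "moment N 1 1 C t = 0" ..
    have "moment N 1 X C t = 0 \<and> 1 / sqrt 2 * moment N 2 1 C t + - 1 * moment N 0 \<phi> C t = 0"
    proof (rule rotation_zero[where c = 2 and u = "moment N 1 X C" and t = t and
          w = "\<lambda>t. 1 / sqrt 2 * moment N 2 1 C t + - 1 * moment N 0 \<phi> C t"])
      fix t :: real assume t: "t \<ge> 0"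
      have "adj X = X * X - 1" by (simp add: adj_X d\<phi>)
      then have "moment N 0 (adj X) C t = 2 * moment N 0 \<phi> C t"
        using X2[OF t] mass_t[OF t] by (simp only: moment_diff)
      moreover have "sqrt 2 * y = 2 * (1 / sqrt 2 * y)" for y :: real
        by (simp add: field_simps)
      ultimately have eq: "sqrt 2 * moment N 2 1 C t - moment N 0 (adj X) C t =
          2 * (1 / sqrt 2 * moment N 2 1 C t + - 1 * moment N 0 \<phi> C t)"
        by (simp only: distrib_left)
      have "pderiv X = 1" by (simp add: pderiv_pCons one_pCons)
      moreover have "degree X \<le> N" using N2 by simp
      ultimately show "(moment N 1 X C has_real_derivative
          2 * (1 / sqrt 2 * moment N 2 1 C t + - 1 * moment N 0 \<phi> C t)) (at t within {0..})"
        using d1[OF t, of X] eq by (simp only:)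
      show "((\<lambda>t. 1 / sqrt 2 * moment N 2 1 C t + - 1 * moment N 0 \<phi> C t) has_real_derivative
          - (2 * moment N 1 X C t)) (at t within {0..})"
        using energy_deriv[OF t, of "- 1"] by (simp add: d\<phi>)
    qed (use harm[OF h] t in auto)
    then show "moment N 1 X C t = 0" ..
  qed
  then show ?thesis
    using ode mass_t energy_t by (auto simp: flows_def)
qed

text \<open>
  The transport terms telescope over \<open>k\<close>, and only the damping of the levels from 3 on remains.\<close>

lemma total_level_deriv:
  assumes ode: "\<And>k n. k \<le> K \<Longrightarrow> n \<le> N \<Longrightarrow>
      (C k n has_real_derivative flow_rhs N k n C t) (at t within {0..})"
    and top: "\<And>n. n \<le> N \<Longrightarrow> C (K + 1) n t = 0" and "K \<ge> 3"
  shows "((\<lambda>t. \<Sum>k\<le>K. level N k C t) has_real_derivative - 2 * (\<Sum>k=3..K. level N k C t))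
    (at t within {0..})"
proof -
  \<comment> \<open>The transport between the levels \<open>k - 1\<close> and \<open>k\<close>; for \<open>k = 0\<close> the factor \<open>sqrt 0\<close> removes the
    meaningless level \<open>0 - 1 = 0\<close>.\<close>
  define T where "T k = sqrt (real k) * (\<Sum>n\<le>N. \<Sum>r\<le>N. C k n t * E (P n * pderiv (P r)) * C (k - 1) r t)" for k
  have *: "(level N k C has_real_derivative 2 * (T (Suc k) - T k - (if k \<ge> 3 then 1 else 0) * level N k C t))
      (at t within {0..})" if "k \<le> K" for k
  proof -
    have "(level N k C has_real_derivative (\<Sum>n\<le>N. 2 * (C k n t * flow_rhs N k n C t))) (at t within {0..})"
      unfolding level_def [abs_def]
    proof (intro DERIV_sum)
      fix n assume "n \<in> {..N}"
      then have "(C k n has_real_derivative flow_rhs N k n C t) (at t within {0..})"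
        using ode that by simp
      from DERIV_power[OF this, of 2]
      show "((\<lambda>t. (C k n t)\<^sup>2) has_real_derivative 2 * (C k n t * flow_rhs N k n C t)) (at t within {0..})"
        by (simp add: algebra_simps)
    qed
    moreover have "(\<Sum>n\<le>N. C k n t * flow_rhs N k n C t) =
        T (Suc k) - T k - (if k \<ge> 3 then 1 else 0) * level N k C t"
    proof -
      have split: "(\<Sum>n\<le>N. x n * (a * U n - b * V n - d * W n)) =
          a * (\<Sum>n\<le>N. x n * U n) - b * (\<Sum>n\<le>N. x n * V n) - d * (\<Sum>n\<le>N. x n * W n)"
        for x U V W :: "nat \<Rightarrow> real" and a b d :: real
        by (simp add: sum_distrib_left sum_subtractf sum.distrib algebra_simps)
      have "(\<Sum>n\<le>N. C k n t * (\<Sum>r\<le>N. E (P r * pderiv (P n)) * C (k + 1) r t)) =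
          (\<Sum>r\<le>N. \<Sum>n\<le>N. C (Suc k) r t * E (P r * pderiv (P n)) * C k n t)"
        unfolding sum_distrib_left by (subst sum.swap) (simp add: mult_ac)
      then have up: "sqrt (real (k + 1)) * (\<Sum>n\<le>N. C k n t * (\<Sum>r\<le>N. E (P r * pderiv (P n)) * C (k + 1) r t)) = T (Suc k)"
        by (simp add: T_def)
      have down: "sqrt (real k) * (\<Sum>n\<le>N. C k n t * (\<Sum>r\<le>N. E (P n * pderiv (P r)) *
          (if k = 0 then 0 else C (k - 1) r t))) = T k"
        by (cases "k = 0") (simp_all add: T_def sum_distrib_left mult.assoc)
      show ?thesis
        unfolding flow_rhs_def split up down by (simp add: level_def power2_eq_square)
    qed
    ultimately show ?thesis by (simp add: sum_distrib_left[symmetric])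
  qed
  have "((\<lambda>t. \<Sum>k\<le>K. level N k C t) has_real_derivative
      (\<Sum>k\<le>K. 2 * (T (Suc k) - T k - (if k \<ge> 3 then 1 else 0) * level N k C t))) (at t within {0..})"
    by (intro DERIV_sum *) simp
  moreover have "(\<Sum>k\<le>K. T (Suc k) - T k) = 0"
  proof -
    have "T (Suc K) = 0" using top by (simp add: T_def)
    moreover have "T 0 = 0" by (simp add: T_def)
    ultimately show ?thesis
      using sum_telescope[of T K] by (simp add: sum_subtractf)
  qed
  moreover have "(\<Sum>k\<le>K. (if k \<ge> 3 then 1 else 0) * level N k C t) = (\<Sum>k=3..K. level N k C t)"
    by (intro sum.mono_neutral_cong_right) auto
  ultimately show ?thesis
    by (simp add: sum_distrib_left[symmetric] sum_subtractf)
qed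

lemma total_level_decay:
  assumes diss: "dissipates (flows N) (low N) (high N) (low N) (1 / 2) B F F'"
    and C: "C \<in> flows N" and "K \<ge> 3"
    and ode: "\<And>k n t. k \<le> K \<Longrightarrow> n \<le> N \<Longrightarrow> t \<ge> 0 \<Longrightarrow>
      (C k n has_real_derivative flow_rhs N k n C t) (at t within {0..})"
    and top: "\<And>n t. n \<le> N \<Longrightarrow> t \<ge> 0 \<Longrightarrow> C (K + 1) n t = 0" and "t \<ge> 0"
  shows "(\<Sum>k\<le>K. level N k C t) \<le> 3 * exp (- (1 / (2 * (B + 1)) / 3) * t) * (\<Sum>k\<le>K. level N k C 0)"
proof (rule exponential_decay[OF diss C, where R = "\<lambda>t. \<Sum>k=3..K. level N k C t" and
      en = "\<lambda>t. \<Sum>k\<le>K. level N k C t"])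
  fix t :: real assume t: "t \<ge> 0"
  show "high N C t \<le> (\<Sum>k=3..K. level N k C t)"
  proof (cases "K = 3")
    case True
    then have "level N 4 C t = 0" using top[OF _ t] by (simp add: level_def)
    then show ?thesis using True by (simp add: high_def)
  next
    case False
    have "high N C t = (\<Sum>k\<in>{3, 4}. level N k C t)" by (simp add: high_def)
    also have "\<dots> \<le> (\<Sum>k=3..K. level N k C t)"
      using False \<open>K \<ge> 3\<close> by (intro sum_mono2) (auto simp: level_nonneg)
    finally show ?thesis .
  qed
  have "{..K} = {..2} \<union> {3..K}" using \<open>K \<ge> 3\<close> by auto
  then have "(\<Sum>k\<le>K. level N k C t) = (\<Sum>k\<le>2. level N k C t) + (\<Sum>k=3..K. level N k C t)"
    by (simp only:) (rule sum.union_disjoint, auto)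
  then show "(\<Sum>k\<le>K. level N k C t) = low N C t + (\<Sum>k=3..K. level N k C t)"
    by (simp add: low_def numeral_2_eq_2)
  show "((\<lambda>t. \<Sum>k\<le>K. level N k C t) has_real_derivative - 2 * (\<Sum>k=3..K. level N k C t)) (at t within {0..})"
    by (rule total_level_deriv) (use ode top t \<open>K \<ge> 3\<close> in auto)
qed (auto simp: low_nonneg high_nonneg \<open>t \<ge> 0\<close>)

end

section \<open>Expansion in phase space\<close>

lemma lborel_integral_product:
  fixes f g :: "real \<Rightarrow> real"
  assumes f: "integrable lborel f" and g: "integrable lborel g"
  shows "integrable lborel (\<lambda>z :: real \<times> real. f (fst z) * g (snd z))"
    and "(LINT z|lborel. f (fst z) * g (snd z)) = (LINT x|lborel. f x) * (LINT y|lborel. g y)"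
proof -
  have [measurable]: "f \<in> borel_measurable lborel" "g \<in> borel_measurable lborel"
    using f g by auto
  have int: "integrable (lborel \<Otimes>\<^sub>M lborel) (\<lambda>z. f (fst z) * g (snd z))"
  proof (rule lborel_pair.Fubini_integrable)
    show "integrable lborel (\<lambda>x. \<integral>y. norm (f (fst (x, y)) * g (snd (x, y))) \<partial>lborel)"
      using f by (simp add: abs_mult)
    show "AE x in lborel. integrable lborel (\<lambda>y. f (fst (x, y)) * g (snd (x, y)))"
      using g by simp
  qed measurable
  then show "integrable lborel (\<lambda>z :: real \<times> real. f (fst z) * g (snd z))"
    by (simp add: lborel_prod)
  from lborel_pair.integral_fst'[OF int]
  show "(LINT z|lborel. f (fst z) * g (snd z)) = (LINT x|lborel. f x) * (LINT y|lborel. g y)"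
    by (simp add: lborel_prod)
qed

lemma integral_square_orthonormal_sum:
  fixes g :: "'i \<Rightarrow> 'a \<Rightarrow> real"
  assumes "finite I"
    and int: "\<And>i j. i \<in> I \<Longrightarrow> j \<in> I \<Longrightarrow> integrable M (\<lambda>z. g i z * g j z * w z)"
    and orth: "\<And>i j. i \<in> I \<Longrightarrow> j \<in> I \<Longrightarrow> (LINT z|M. g i z * g j z * w z) = (if i = j then 1 else 0)"
  shows "(LINT z|M. (\<Sum>i\<in>I. a i * g i z)\<^sup>2 * w z) = (\<Sum>i\<in>I. (a i)\<^sup>2)"
proof -
  have "(\<Sum>i\<in>I. a i * g i z)\<^sup>2 * w z = (\<Sum>i\<in>I. \<Sum>j\<in>I. a i * a j * (g i z * g j z * w z))" for z
  proof -
    have "(\<Sum>i\<in>I. a i * g i z)\<^sup>2 = (\<Sum>i\<in>I. \<Sum>j\<in>I. (a i * g i z) * (a j * g j z))"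
      by (simp only: power2_eq_square sum_product)
    then show ?thesis by (simp only: sum_distrib_left sum_distrib_right mult_ac)
  qed
  then have "(LINT z|M. (\<Sum>i\<in>I. a i * g i z)\<^sup>2 * w z) =
      (\<Sum>i\<in>I. \<Sum>j\<in>I. a i * a j * (LINT z|M. g i z * g j z * w z))"
    by (simp add: int)
  also have "\<dots> = (\<Sum>i\<in>I. \<Sum>j\<in>I. if i = j then (a i)\<^sup>2 else 0)"
    by (intro sum.cong refl) (simp add: orth power2_eq_square)
  also have "\<dots> = (\<Sum>i\<in>I. (a i)\<^sup>2)" using assms(1) by simp
  finally show ?thesis .
qed

locale phase_space = orthonormal_potential +
  fixes H :: "nat \<Rightarrow> real poly"
  assumes hermite: "orthonormal_polys std_normal_density H"
begin

lemma H_integral: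
  "(LINT v|lborel. poly (H k) v * poly (H l) v * std_normal_density v) = (if k = l then 1 else 0)"
  using hermite unfolding orthonormal_polys_def by auto

lemma integrable_HH: "integrable lborel (\<lambda>v. poly (H k) v * poly (H l) v * std_normal_density v)"
proof -
  have square: "integrable lborel (\<lambda>v. poly (H k) v * poly (H k) v * std_normal_density v)" for k
    using H_integral[of k k] not_integrable_integral_eq by fastforce
  show ?thesis
    by (rule integrable_weighted_product[OF square square]) auto
qed

text \<open>
  The functions \<open>basis k n\<close> are orthonormal in phase space, which identifies the norm of a solution with the
  Euclidean norm of its coefficients.\<close>

definition basis :: "nat \<Rightarrow> nat \<Rightarrow> real \<times> real \<Rightarrow> real" where
  "basis k n z = poly (P n) (fst z) * poly (H k) (snd z)"

lemma basis_product:
  "basis k n z * basis l m z * Maxw \<phi> z =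
    (poly (P n) (fst z) * poly (P m) (fst z) * rho \<phi> (fst z)) *
    (poly (H k) (snd z) * poly (H l) (snd z) * std_normal_density (snd z))"
  by (simp add: basis_def Maxw_def case_prod_beta)

lemma integrable_basis: "integrable lborel (\<lambda>z. basis k n z * basis l m z * Maxw \<phi> z)"
  unfolding basis_product by (rule lborel_integral_product[OF integrable_PP integrable_HH])

lemma basis_orthonormal:
  "(LINT z|lborel. basis k n z * basis l m z * Maxw \<phi> z) = (if (k, n) = (l, m) then 1 else 0)"
  unfolding basis_product lborel_integral_product(2)[OF integrable_PP integrable_HH]
    P_integral H_integral by simp

lemma Maxw_nonneg: "Maxw \<phi> z \<ge> 0"
  by (simp add: Maxw_def case_prod_beta rho_def)

lemma basis_measurable [measurable]: "basis k n \<in> borel_measurable borel"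
  unfolding basis_def [abs_def] borel_prod[symmetric] by measurable

lemma Maxw_measurable [measurable]: "Maxw \<phi> \<in> borel_measurable borel"
  unfolding Maxw_def borel_prod[symmetric] by measurable

lemma L2_norm_expansion:
  assumes "\<And>x v. f (x, v) = (\<Sum>k\<le>K. (\<Sum>n\<le>N. C k n * poly (P n) x) * poly (H k) v)"
  shows "L2_norm \<phi> f = sqrt (\<Sum>k\<le>K. \<Sum>n\<le>N. (C k n)\<^sup>2)"
proof -
  define I where "I = {..K} \<times> {..N}"
  have f: "f z = (\<Sum>i\<in>I. C (fst i) (snd i) * basis (fst i) (snd i) z)" for z
  proof -
    have "f z = f (fst z, snd z)" by simp
    also have "\<dots> = (\<Sum>k\<le>K. \<Sum>n\<le>N. C k n * basis k n z)"
      unfolding assms basis_def by (simp add: sum_distrib_right mult.assoc)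
    finally show ?thesis by (simp add: I_def sum.cartesian_product case_prod_beta)
  qed
  have "(LINT z|lborel. (f z)\<^sup>2 * Maxw \<phi> z) = (\<Sum>i\<in>I. (C (fst i) (snd i))\<^sup>2)"
    unfolding f
    by (rule integral_square_orthonormal_sum)
      (auto simp: I_def integrable_basis basis_orthonormal simp del: prod.inject split: if_splits)
  then show ?thesis
    by (simp add: L2_norm_def I_def sum.cartesian_product case_prod_beta)
qed

lemma integrable_basis_L2:
  assumes "in_L2 \<phi> h0"
  shows "integrable lborel (\<lambda>z. h0 z * basis k n z * Maxw \<phi> z)"
  by (rule integrable_weighted_product)
    (use assms in \<open>auto simp: in_L2_def power2_eq_square integrable_basis Maxw_nonneg\<close>)

lemma avg_v_moment:
  assumes h0: "in_L2 \<phi> h0"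
  shows "integrable lborel (\<lambda>x. poly (P n) x * v_moment H k h0 x * rho \<phi> x)"
    and "(LINT x|lborel. poly (P n) x * v_moment H k h0 x * rho \<phi> x) =
      (LINT z|lborel. h0 z * basis k n z * Maxw \<phi> z)"
proof -
  have int: "integrable (lborel \<Otimes>\<^sub>M lborel) (\<lambda>z. h0 z * basis k n z * Maxw \<phi> z)"
    using integrable_basis_L2[OF h0] by (simp add: lborel_prod)
  have eq: "(LINT v|lborel. h0 (x, v) * basis k n (x, v) * Maxw \<phi> (x, v)) =
      poly (P n) x * v_moment H k h0 x * rho \<phi> x" for x
  proof -
    have "h0 (x, v) * basis k n (x, v) * Maxw \<phi> (x, v) =
        poly (P n) x * rho \<phi> x * (h0 (x, v) * poly (H k) v * std_normal_density v)" for v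
      by (simp add: basis_def Maxw_def)
    then have "(LINT v|lborel. h0 (x, v) * basis k n (x, v) * Maxw \<phi> (x, v)) =
        (LINT v|lborel. poly (P n) x * rho \<phi> x * (h0 (x, v) * poly (H k) v * std_normal_density v))"
      by (simp only:)
    then show ?thesis by (simp add: v_moment_def)
  qed
  show "integrable lborel (\<lambda>x. poly (P n) x * v_moment H k h0 x * rho \<phi> x)"
    using lborel_pair.integrable_fst'[OF int] unfolding eq .
  show "(LINT x|lborel. poly (P n) x * v_moment H k h0 x * rho \<phi> x) =
      (LINT z|lborel. h0 z * basis k n z * Maxw \<phi> z)"
    using lborel_pair.integral_fst'[OF int] unfolding eq lborel_prod .
qed

text \<open>
  A moment of the truncated initial datum is the moment of \<open>h0\<close> itself as long as the test polynomial is
  resolved by the truncation; thus the assumptions on \<open>h0\<close> are assumptions on the coefficients.\<close>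

lemma moment_initial:
  assumes h0: "in_L2 \<phi> h0" and "degree f \<le> N"
    and C: "\<And>n. n \<le> N \<Longrightarrow> C k n 0 = (LINT z|lborel. h0 z * basis k n z * Maxw \<phi> z)"
  shows "moment N k f C 0 = avg \<phi> (\<lambda>x. poly f x * v_moment H k h0 x)"
proof -
  have "poly f x * v_moment H k h0 x * rho \<phi> x =
      (\<Sum>n\<le>N. E (f * P n) * (poly (P n) x * v_moment H k h0 x * rho \<phi> x))" for x
    using arg_cong[OF expand[OF assms(2)], of "\<lambda>p. poly p x"]
    by (simp add: poly_sum sum_distrib_right mult.assoc)
  then have "avg \<phi> (\<lambda>x. poly f x * v_moment H k h0 x) =
      (\<Sum>n\<le>N. E (f * P n) * (LINT x|lborel. poly (P n) x * v_moment H k h0 x * rho \<phi> x))"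
    by (simp add: avg_def avg_v_moment(1)[OF h0])
  also have "\<dots> = moment N k f C 0"
    unfolding moment_def by (intro sum.cong refl) (simp add: C avg_v_moment(2)[OF h0])
  finally show ?thesis ..
qed

lemma scheme_decay:
  assumes diss: "dissipates (flows N) (low N) (high N) (low N) (1 / 2) B F F'"
    and N: "N \<ge> degree \<phi>" and K: "K \<ge> 3"
    and h0: "in_L2 \<phi> h0" and inv: "zero_invariants \<phi> H h0"
    and sol: "semi_discrete_solution \<phi> P H K N h0 h" and t: "t \<ge> 0"
  shows "L2_norm \<phi> (h t) \<le> sqrt 3 * exp (- (1 / (12 * (B + 1))) * t) * L2_norm \<phi> (h 0)"
proof -
  obtain C where scheme: "scheme_coeffs \<phi> P H K N h0 C"
    and h: "\<And>t x v. t \<ge> 0 \<Longrightarrow> h t (x, v) = (\<Sum>k\<le>K. (\<Sum>n\<le>N. C k n t * poly (P n) x) * poly (H k) v)"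
    using sol unfolding semi_discrete_solution_def by blast
  have ode: "(C k n has_real_derivative flow_rhs N k n C t) (at t within {0..})"
    if "k \<le> K" "n \<le> N" "t \<ge> 0" for k n t
    using scheme that unfolding scheme_coeffs_def flow_rhs_def ip_poly by blast
  have top: "C (K + 1) n t = 0" if "n \<le> N" "t \<ge> 0" for n t
    using scheme that unfolding scheme_coeffs_def by blast
  have init: "C k n 0 = (LINT z|lborel. h0 z * basis k n z * Maxw \<phi> z)" if "k \<le> K" "n \<le> N" for k n
  proof -
    have "C k n 0 = (LINT (x, v)|lborel. h0 (x, v) * poly (P n) x * poly (H k) v * Maxw \<phi> (x, v))"
      using scheme that unfolding scheme_coeffs_def by blast
    then show ?thesis by (simp add: basis_def case_prod_beta' mult.assoc)
  qed
  have mom: "moment N k f C 0 = avg \<phi> (\<lambda>x. poly f x * v_moment H k h0 x)"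
    if "k \<le> 3" "degree f \<le> N" for k f
    by (rule moment_initial[OF h0 that(2)]) (use init that K in simp)
  have N2: "N \<ge> 2" using N degree_\<phi> by simp
  note inv' = inv[unfolded zero_invariants_def Let_def]
  have flow: "C \<in> flows N"
  proof (rule flowsI[OF _ N])
    show "(C k n has_real_derivative flow_rhs N k n C t) (at t within {0..})"
      if "k \<le> 3" "n \<le> N" "t \<ge> 0" for k n t
      using ode that K by simp
    show "moment N 0 1 C 0 = 0" using inv' by (simp add: mom)
    show "1 / sqrt 2 * moment N 2 1 C 0 + moment N 0 \<phi> C 0 = 0" using inv' N by (simp add: mom)
    show "moment N 0 X C 0 = 0 \<and> moment N 1 1 C 0 = 0 \<and> moment N 1 X C 0 = 0 \<and>
        1 / sqrt 2 * moment N 2 1 C 0 - moment N 0 \<phi> C 0 = 0" if "harmonic \<phi>"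
      using inv' that N N2 by (simp add: mom)
  qed
  have norm: "L2_norm \<phi> (h s) = sqrt (\<Sum>k\<le>K. level N k C s)" if "s \<ge> 0" for s
    unfolding level_def by (rule L2_norm_expansion) (rule h[OF that])
  \<comment> \<open>The norm is the square root of the energy, so its rate is half the rate of the energy.\<close>
  define lam where "lam = 1 / (12 * (B + 1))"
  have "B \<ge> 0" using dissipatesD(1)[OF diss] .
  then have lam: "1 / (2 * (B + 1)) / 3 = 2 * lam" by (simp add: lam_def field_simps)
  have "(\<Sum>k\<le>K. level N k C t) \<le> 3 * exp (- (2 * lam) * t) * (\<Sum>k\<le>K. level N k C 0)"
    using total_level_decay[OF diss flow K ode top t] unfolding lam by simp
  also have "exp (- (2 * lam) * t) = (exp (- lam * t))\<^sup>2"
    by (simp add: power2_eq_square flip: exp_add)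
  finally have "sqrt (\<Sum>k\<le>K. level N k C t) \<le> sqrt (3 * (exp (- lam * t))\<^sup>2 * (\<Sum>k\<le>K. level N k C 0))"
    by (rule real_sqrt_le_mono)
  also have "\<dots> = sqrt 3 * exp (- lam * t) * sqrt (\<Sum>k\<le>K. level N k C 0)"
    by (simp add: real_sqrt_mult)
  finally show ?thesis using norm[OF t] norm[of 0] by (simp add: lam_def)
qed

end

section \<open>The decay theorem\<close>

theorem theorem1p2:
  fixes \<phi> :: "real poly" and N :: nat
  assumes "potential \<phi>"
    and "N \<ge> degree \<phi>"
  shows "\<exists>\<omega> lam :: real. \<omega> > 0 \<and> lam > 0 \<and>
    (\<forall>P H. orthonormal_polys (rho \<phi>) P \<longrightarrow> orthonormal_polys std_normal_density H \<longrightarrow>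
      (\<forall>K\<ge>3. \<forall>h0 h.
        in_L2 \<phi> h0 \<longrightarrow> zero_invariants \<phi> H h0 \<longrightarrow> semi_discrete_solution \<phi> P H K N h0 h \<longrightarrow>
        (\<forall>t\<ge>0. L2_norm \<phi> (h t) \<le> \<omega> * exp (- lam * t) * L2_norm \<phi> (h 0))))"
proof (cases "\<exists>P. orthonormal_polys (rho \<phi>) P")
  case False
  \<comment> \<open>Without an orthonormal basis there is nothing to estimate.\<close>
  then show ?thesis by (intro exI[of _ 1]) auto
next
  case True
  then obtain P where P: "orthonormal_polys (rho \<phi>) P" by blast
  interpret orthonormal_potential \<phi> P by unfold_locales (fact assms(1) P)+
  obtain B F F' where diss: "dissipates (flows N) (low N) (high N) (low N) (1 / 2) B F F'"
    using low_dissipates[OF assms(2), of "1 / 2"] by auto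
  have decay: "L2_norm \<phi> (h t) \<le> sqrt 3 * exp (- (1 / (12 * (B + 1))) * t) * L2_norm \<phi> (h 0)"
    if "orthonormal_polys (rho \<phi>) Q" "orthonormal_polys std_normal_density H" "K \<ge> 3"
      "in_L2 \<phi> h0" "zero_invariants \<phi> H h0" "semi_discrete_solution \<phi> Q H K N h0 h" "t \<ge> 0"
    for Q H K h0 h t
  proof -
    have "Q = P" by (rule orthonormal_polys_unique[OF assms(1) that(1) P])
    interpret phase_space \<phi> P H by unfold_locales (fact that(2))
    show ?thesis
      using scheme_decay[OF diss assms(2) that(3-5) _ that(7)] that(6) \<open>Q = P\<close> by simp
  qed
  have "1 / (12 * (B + 1)) > 0" using dissipatesD(1)[OF diss] by simp
  with decay show ?thesis
    by (intro exI[of _ "sqrt 3"] exI[of _ "1 / (12 * (B + 1))"]) auto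
qed

end
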